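(* None of the following four topological spaces is definable in any o-minimal structure, i.e. for each of them, there is no o-minimal structure $M$ and no topological space definable in $M$ that is homeomorphic to it: (1) the Arens space; (2) the maximal compact topology; (3) the one point compactification of the rationals; (4) the Appert space.
   Context: O-minimality is understood in the sense of van den Dries' book "Tame Topology and O-minimal Structures": $M$ is an expansion of a dense linear order $(M,<)$ without endpoints such that every subset of $M$ definable with parameters is a finite union of points and open intervals with endpoints in $M\cup\{-\infty,+\infty\}$. "Definable" means definable in $M$, possibly with parameters from $M$. A topological space $(A,\tau)$ is definable in $M$ when $A\subseteq M^n$ (for some $n$) is a definable set and there exists a definable basis for the topology $\tau$, i.e. a basis of the form $\{\varphi(A;b) : b\in B\}$ for some formula $\varphi(x;y)$ with $|x|=n$ and some definable set $B\subseteq M^{|y|}$, where $\varphi(A;b)=\{a\in A : M\models\varphi(a;b)\}$. The four (countable) spaces are the following. Arens space: the underlying set consists of distinct points $\infty$, $x_n$ ($n\in\mathbb{N}$) and $x_{n,m}$ ($n,m\in\mathbb{N}$). A set $U$ is open if and only if: whenever $\infty\in U$, then $x_n\in U$ for all but finitely many $n$; and, for every $n$, whenever $x_n\in U$, then $x_{n,m}\in U$ for all but finitely many $m$. Maximal compact topology: the underlying set is $X=(\mathbb{Z}_{>0}\times\mathbb{Z}_{>0})\cup\{x,y\}$ with $x\neq y$ two additional points. Each point of $\mathbb{Z}_{>0}\times\mathbb{Z}_{>0}$ is isolated; the basic open neighborhoods of $x$ are the sets $X\setminus(\{y\}\cup P)$ where $P\subseteq \mathbb{Z}_{>0}\times\mathbb{Z}_{>0}$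 contains at most finitely many points of each row; the basic open neighborhoods of $y$ are the sets $X\setminus(\{x\}\cup Q)$ where $Q\subseteq\mathbb{Z}_{>0}\times\mathbb{Z}_{>0}$ is contained in a union of finitely many rows. (A row is a set of the form $\mathbb{Z}_{>0}\times\{j\}$.) One point compactification of the rationals: the underlying set is $\mathbb{Q}\cup\{\infty\}$; the open sets are the open subsets of $\mathbb{Q}$ (with the usual Euclidean topology) together with the sets $(\mathbb{Q}\setminus K)\cup\{\infty\}$ with $K\subseteq\mathbb{Q}$ compact. Appert space: the underlying set is $\mathbb{Z}_{>0}$; for $E\subseteq\mathbb{Z}_{>0}$ let $N(n,E)=|\{m\in E : m\leq n\}|$. A set $E$ is open if and only if either $1\notin E$, or $1\in E$ and $\lim_{n\to\infty} N(n,E)/n=1$. *)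

theory Defs
  imports "HOL-Analysis.Analysis"
begin

section \<open>First-order structures expanding a linear order\<close>

text \<open>The universe of a structure is the whole type \<open>'m\<close>. Its order is the one of the type
  class and has the dedicated atomic formula \<open>Less\<close>; the record collects the additional function
  and relation symbols, their arities and their interpretations. The language is the pair of sets
  \<open>funs\<close>, \<open>rels\<close>, which may be empty. Only values at lists of the correct length matter.\<close>

record ('f, 'r, 'm) fo_struct =
  funs :: "'f set"
  fun_arity :: "'f \<Rightarrow> nat"
  fun_interp :: "'f \<Rightarrow> 'm list \<Rightarrow> 'm"
  rels :: "'r set"
  rel_arity :: "'r \<Rightarrow> nat"
  rel_interp :: "'r \<Rightarrow> 'm list \<Rightarrow> bool"

datatype 'f fo_term = Var nat | App 'f "'f fo_term list"

datatype ('f, 'r) fo_form =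
    Eq "'f fo_term" "'f fo_term"
  | Less "'f fo_term" "'f fo_term"
  | Pred 'r "'f fo_term list"
  | Neg "('f, 'r) fo_form"
  | Conj "('f, 'r) fo_form" "('f, 'r) fo_form"
  | Exists nat "('f, 'r) fo_form"

fun wf_term :: "('f, 'r, 'm) fo_struct \<Rightarrow> 'f fo_term \<Rightarrow> bool" where
  "wf_term M (Var i) \<longleftrightarrow> True"
| "wf_term M (App f ts) \<longleftrightarrow>
     f \<in> funs M \<and> length ts = fun_arity M f \<and> (\<forall>t\<in>set ts. wf_term M t)"

primrec wf_form :: "('f, 'r, 'm) fo_struct \<Rightarrow> ('f, 'r) fo_form \<Rightarrow> bool" where
  "wf_form M (Eq s t) \<longleftrightarrow> wf_term M s \<and> wf_term M t"
| "wf_form M (Less s t) \<longleftrightarrow> wf_term M s \<and> wf_term M t"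
| "wf_form M (Pred r ts) \<longleftrightarrow>
     r \<in> rels M \<and> length ts = rel_arity M r \<and> (\<forall>t\<in>set ts. wf_term M t)"
| "wf_form M (Neg \<phi>) \<longleftrightarrow> wf_form M \<phi>"
| "wf_form M (Conj \<phi> \<psi>) \<longleftrightarrow> wf_form M \<phi> \<and> wf_form M \<psi>"
| "wf_form M (Exists i \<phi>) \<longleftrightarrow> wf_form M \<phi>"

fun term_vars :: "'f fo_term \<Rightarrow> nat set" where
  "term_vars (Var i) = {i}"
| "term_vars (App f ts) = (\<Union>t\<in>set ts. term_vars t)"

primrec free_vars :: "('f, 'r) fo_form \<Rightarrow> nat set" where
  "free_vars (Eq s t) = term_vars s \<union> term_vars t"
| "free_vars (Less s t) = term_vars s \<union> term_vars t"
| "free_vars (Pred r ts) = (\<Union>t\<in>set ts. term_vars t)"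
| "free_vars (Neg \<phi>) = free_vars \<phi>"
| "free_vars (Conj \<phi> \<psi>) = free_vars \<phi> \<union> free_vars \<psi>"
| "free_vars (Exists i \<phi>) = free_vars \<phi> - {i}"

fun eval_term :: "('f, 'r, 'm) fo_struct \<Rightarrow> (nat \<Rightarrow> 'm) \<Rightarrow> 'f fo_term \<Rightarrow> 'm" where
  "eval_term M e (Var i) = e i"
| "eval_term M e (App f ts) = fun_interp M f (map (eval_term M e) ts)"

primrec sat ::
  "('f, 'r, 'm::linorder) fo_struct \<Rightarrow> (nat \<Rightarrow> 'm) \<Rightarrow> ('f, 'r) fo_form \<Rightarrow> bool" where
  "sat M e (Eq s t) \<longleftrightarrow> eval_term M e s = eval_term M e t"
| "sat M e (Less s t) \<longleftrightarrow> eval_term M e s < eval_term M e t"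
| "sat M e (Pred r ts) \<longleftrightarrow> rel_interp M r (map (eval_term M e) ts)"
| "sat M e (Neg \<phi>) \<longleftrightarrow> \<not> sat M e \<phi>"
| "sat M e (Conj \<phi> \<psi>) \<longleftrightarrow> sat M e \<phi> \<and> sat M e \<psi>"
| "sat M e (Exists i \<phi>) \<longleftrightarrow> (\<exists>a. sat M (e(i := a)) \<phi>)"

text \<open>Elements of $M^n$ are lists of length \<open>n\<close>. A formula $\varphi(x;y)$ with $|x| = n$ and
  $|y| = k$ is a formula with free variables among $0, \ldots, n+k-1$, where the first \<open>n\<close>
  variables are $x$ and the last \<open>k\<close> variables are $y$.\<close>

definition partitioned_form ::
  "('f, 'r, 'm) fo_struct \<Rightarrow> nat \<Rightarrow> nat \<Rightarrow> ('f, 'r) fo_form \<Rightarrow> bool" where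
  "partitioned_form M n k \<phi> \<longleftrightarrow> wf_form M \<phi> \<and> free_vars \<phi> \<subseteq> {..<n + k}"

definition fibre ::
  "('f, 'r, 'm::linorder) fo_struct \<Rightarrow> ('f, 'r) fo_form \<Rightarrow> 'm list set \<Rightarrow> 'm list \<Rightarrow> 'm list set" where
  "fibre M \<phi> A b = {a \<in> A. sat M (\<lambda>i. (a @ b) ! i) \<phi>}"

definition definable_set :: "('f, 'r, 'm::linorder) fo_struct \<Rightarrow> nat \<Rightarrow> 'm list set \<Rightarrow> bool" where
  "definable_set M n X \<longleftrightarrow>
     (\<exists>\<phi> k c. partitioned_form M n k \<phi> \<and> length c = k \<and> X = fibre M \<phi> {a. length a = n} c)"

text \<open>The intervals below are the open intervals with endpoints in $M \cup \{-\infty, +\infty\}$.\<close>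

definition point_or_interval :: "'m::linorder set \<Rightarrow> bool" where
  "point_or_interval I \<longleftrightarrow>
     (\<exists>a. I = {a}) \<or> (\<exists>a b. I = {a<..<b}) \<or> (\<exists>b. I = {..<b}) \<or> (\<exists>a. I = {a<..}) \<or> I = UNIV"

definition o_minimal :: "('f, 'r, 'm::unbounded_dense_linorder) fo_struct \<Rightarrow> bool" where
  "o_minimal M \<longleftrightarrow>
     (\<forall>X. definable_set M 1 X \<longrightarrow>
        (\<exists>\<I>. finite \<I> \<and> (\<forall>I\<in>\<I>. point_or_interval I) \<and> {a. [a] \<in> X} = \<Union>\<I>))"

definition definable_topology ::
  "('f, 'r, 'm::linorder) fo_struct \<Rightarrow> 'm list topology \<Rightarrow> bool" where
  "definable_topology M T \<longleftrightarrow>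
     (\<exists>n. definable_set M n (topspace T) \<and>
        (\<exists>\<phi> k B. partitioned_form M n k \<phi> \<and> definable_set M k B \<and>
           openin T = arbitrary union_of (\<lambda>V. \<exists>b\<in>B. V = fibre M \<phi> (topspace T) b)))"


section \<open>The Arens space\<close>

datatype arens_point = ArensInf | ArensSeq nat | ArensDbl nat nat

definition arens_space :: "arens_point topology" where
  "arens_space = topology (\<lambda>U.
     (ArensInf \<in> U \<longrightarrow> (\<forall>\<^sub>F n in cofinite. ArensSeq n \<in> U)) \<and>
     (\<forall>n. ArensSeq n \<in> U \<longrightarrow> (\<forall>\<^sub>F m in cofinite. ArensDbl n m \<in> U)))"

lemma openin_arens_space:
  "openin arens_space U \<longleftrightarrow>
     (ArensInf \<in> U \<longrightarrow> (\<forall>\<^sub>F n in cofinite. ArensSeq n \<in> U)) \<and>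
     (\<forall>n. ArensSeq n \<in> U \<longrightarrow> (\<forall>\<^sub>F m in cofinite. ArensDbl n m \<in> U))"
proof -
  define L where "L = (\<lambda>U.
     (ArensInf \<in> U \<longrightarrow> (\<forall>\<^sub>F n in cofinite. ArensSeq n \<in> U)) \<and>
     (\<forall>n. ArensSeq n \<in> U \<longrightarrow> (\<forall>\<^sub>F m in cofinite. ArensDbl n m \<in> U)))"
  have "L (S \<inter> T)" if "L S" "L T" for S T
    using that by (simp add: L_def eventually_conj_iff)
  moreover have "L (\<Union>\<K>)" if \<K>: "\<forall>K\<in>\<K>. L K" for \<K>
  proof -
    have mono: "\<forall>\<^sub>F i in cofinite. g i \<in> \<Union>\<K>"
      if "K \<in> \<K>" "\<forall>\<^sub>F i in cofinite. g i \<in> K" for g :: "nat \<Rightarrow> arens_point" and K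
      using that(2) by (rule eventually_mono) (use that(1) in blast)
    have "\<forall>\<^sub>F n in cofinite. ArensSeq n \<in> \<Union>\<K>" if inf: "ArensInf \<in> \<Union>\<K>"
    proof -
      obtain K where K: "K \<in> \<K>" "ArensInf \<in> K" using inf by (rule UnionE)
      then have "\<forall>\<^sub>F n in cofinite. ArensSeq n \<in> K" using \<K> by (simp add: L_def)
      then show ?thesis by (rule mono[OF K(1)])
    qed
    moreover have "\<forall>\<^sub>F m in cofinite. ArensDbl n m \<in> \<Union>\<K>" if seq: "ArensSeq n \<in> \<Union>\<K>" for n
    proof -
      obtain K where K: "K \<in> \<K>" "ArensSeq n \<in> K" using seq by (rule UnionE)
      then have "\<forall>\<^sub>F m in cofinite. ArensDbl n m \<in> K" using \<K> by (simp add: L_def)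
      then show ?thesis by (rule mono[OF K(1)])
    qed
    ultimately show ?thesis by (simp add: L_def)
  qed
  ultimately have "istopology L"
    unfolding istopology_def by blast
  then have "openin arens_space U \<longleftrightarrow> L U"
    by (simp add: arens_space_def topology_inverse' flip: L_def)
  then show ?thesis
    by (simp add: L_def)
qed

lemma topspace_arens_space: "topspace arens_space = UNIV"
proof -
  have "openin arens_space UNIV"
    by (simp add: openin_arens_space)
  then show ?thesis
    by (metis openin_subset top.extremum_uniqueI)
qed


section \<open>The maximal compact topology\<close>

datatype max_compact_point = MCPair nat nat | MCX | MCY

definition mc_grid :: "max_compact_point set" where
  "mc_grid = {MCPair i j | i j. 0 < i \<and> 0 < j}"

definition mc_row :: "nat \<Rightarrow> max_compact_point set" where
  "mc_row j = {MCPair i j | i. 0 < i}"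

definition mc_set :: "max_compact_point set" where
  "mc_set = mc_grid \<union> {MCX, MCY}"

definition mc_base :: "max_compact_point set set" where
  "mc_base =
     {{p} | p. p \<in> mc_grid} \<union>
     {mc_set - ({MCY} \<union> P) | P. P \<subseteq> mc_grid \<and> (\<forall>j>0. finite (P \<inter> mc_row j))} \<union>
     {mc_set - ({MCX} \<union> Q) | Q. \<exists>J. finite J \<and> J \<subseteq> {0<..} \<and> Q \<subseteq> (\<Union>j\<in>J. mc_row j)}"

definition max_compact_space :: "max_compact_point topology" where
  "max_compact_space = topology (arbitrary union_of (\<lambda>V. V \<in> mc_base))"

lemma openin_max_compact_space:
  "openin max_compact_space = arbitrary union_of (\<lambda>V. V \<in> mc_base)"
proof -
  have grid: "(arbitrary union_of (\<lambda>V. V \<in> mc_base)) W" if "W \<subseteq> mc_grid" for W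
  proof -
    have "(\<lambda>p. {p}) ` W \<subseteq> mc_base"
      using that by (auto simp: mc_base_def)
    moreover have "W = \<Union> ((\<lambda>p. {p}) ` W)"
      by auto
    ultimately show ?thesis
      unfolding union_of_def arbitrary_def by blast
  qed
  have "(arbitrary union_of (\<lambda>V. V \<in> mc_base)) (S \<inter> T)"
    if ST: "S \<in> mc_base" "T \<in> mc_base" for S T
  proof (cases "S \<inter> T \<subseteq> mc_grid")
    case True
    then show ?thesis by (rule grid)
  next
    case False
    have not_grid: "MCX \<notin> mc_grid" "MCY \<notin> mc_grid"
      by (auto simp: mc_grid_def)
    have row_grid: "mc_row j \<subseteq> mc_grid" if "0 < j" for j
      using that by (auto simp: mc_grid_def mc_row_def)
    have sub: "V \<subseteq> mc_set" if "V \<in> mc_base" for V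
      using that by (auto simp: mc_base_def mc_set_def)
    consider "MCX \<in> S \<inter> T" | "MCY \<in> S \<inter> T"
      using False sub[OF ST(1)] by (auto simp: mc_set_def)
    then have "S \<inter> T \<in> mc_base"
    proof cases
      case 1
      have *: "\<exists>P. V = mc_set - ({MCY} \<union> P) \<and> P \<subseteq> mc_grid \<and> (\<forall>j>0. finite (P \<inter> mc_row j))"
        if "V \<in> mc_base" "MCX \<in> V" for V
        using that not_grid by (auto simp: mc_base_def)
      obtain P where P: "S = mc_set - ({MCY} \<union> P)" "P \<subseteq> mc_grid" "\<forall>j>0. finite (P \<inter> mc_row j)"
        using *[OF ST(1)] 1 by blast
      obtain P' where P': "T = mc_set - ({MCY} \<union> P')" "P' \<subseteq> mc_grid"
          "\<forall>j>0. finite (P' \<inter> mc_row j)"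
        using *[OF ST(2)] 1 by blast
      have "S \<inter> T = mc_set - ({MCY} \<union> (P \<union> P'))" "P \<union> P' \<subseteq> mc_grid"
        "\<forall>j>0. finite ((P \<union> P') \<inter> mc_row j)"
        using P P' by (auto simp: Int_Un_distrib2)
      then show ?thesis
        unfolding mc_base_def by blast
    next
      case 2
      have *: "\<exists>Q J. V = mc_set - ({MCX} \<union> Q) \<and> finite J \<and> J \<subseteq> {0<..} \<and> Q \<subseteq> (\<Union>j\<in>J. mc_row j)"
        if "V \<in> mc_base" "MCY \<in> V" for V
        using that not_grid by (auto simp: mc_base_def)
      obtain Q J where Q: "S = mc_set - ({MCX} \<union> Q)" "finite J" "J \<subseteq> {0<..}"
          "Q \<subseteq> (\<Union>j\<in>J. mc_row j)"
        using *[OF ST(1)] 2 by blast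
      obtain Q' J' where Q': "T = mc_set - ({MCX} \<union> Q')" "finite J'" "J' \<subseteq> {0<..}"
          "Q' \<subseteq> (\<Union>j\<in>J'. mc_row j)"
        using *[OF ST(2)] 2 by blast
      have "S \<inter> T = mc_set - ({MCX} \<union> (Q \<union> Q'))"
        using Q(1) Q'(1) by auto
      moreover have "finite (J \<union> J')" "J \<union> J' \<subseteq> {0<..}"
        using Q Q' by auto
      moreover have "Q \<union> Q' \<subseteq> (\<Union>j\<in>J \<union> J'. mc_row j)"
        using Q(4) Q'(4) by auto
      ultimately have "\<exists>R. S \<inter> T = mc_set - ({MCX} \<union> R) \<and>
          (\<exists>J. finite J \<and> J \<subseteq> {0<..} \<and> R \<subseteq> (\<Union>j\<in>J. mc_row j))"
        by (intro exI[of _ "Q \<union> Q'"] exI[of _ "J \<union> J'"] conjI)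
      then show ?thesis
        unfolding mc_base_def by (intro UnI2 CollectI)
    qed
    then show ?thesis
      unfolding arbitrary_def by (simp add: union_of_inc)
  qed
  then have "istopology (arbitrary union_of (\<lambda>V. V \<in> mc_base))"
    by (simp add: istopology_base_eq)
  then show ?thesis
    by (simp add: max_compact_space_def topology_inverse')
qed

lemma topspace_max_compact_space: "topspace max_compact_space = mc_set"
proof -
  have "V \<subseteq> mc_set" if "V \<in> mc_base" for V
    using that by (auto simp: mc_base_def mc_set_def)
  moreover have "mc_set - ({MCY} \<union> {}) \<in> mc_base" "mc_set - ({MCX} \<union> {}) \<in> mc_base"
    unfolding mc_base_def by blast+
  moreover have "mc_set = (mc_set - ({MCY} \<union> {})) \<union> (mc_set - ({MCX} \<union> {}))"
    by auto
  ultimately have "\<Union> mc_base = mc_set"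
    by blast
  moreover have "topspace max_compact_space = \<Union> mc_base"
    unfolding topspace_def openin_max_compact_space union_of_def arbitrary_def by blast
  ultimately show ?thesis by simp
qed


section \<open>The one point compactification of the rationals\<close>

definition rat_compactification :: "real option topology" where
  "rat_compactification = Alexandroff_compactification (top_of_set \<rat>)"

lemma openin_rat_compactification:
  "openin rat_compactification V \<longleftrightarrow>
     (\<exists>U. openin (top_of_set \<rat>) U \<and> V = Some ` U) \<or>
     (\<exists>K. K \<subseteq> \<rat> \<and> compact K \<and> V = insert None (Some ` (\<rat> - K)))"
proof -
  have "compactin (top_of_set \<rat>) K \<and> closedin (top_of_set \<rat>) K \<longleftrightarrow> K \<subseteq> \<rat> \<and> compact K"
    for K :: "real set"
  proof -
    have "closedin (top_of_set \<rat>) K" if "K \<subseteq> \<rat>" "compact K"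
      using that by (intro closed_subset compact_imp_closed)
    moreover have "compactin (top_of_set \<rat>) K \<longleftrightarrow> K \<subseteq> \<rat> \<and> compact K"
      by (simp only: compactin_subtopology compactin_euclidean_iff conj_commute)
    ultimately show ?thesis by blast
  qed
  then show ?thesis
    unfolding rat_compactification_def openin_Alexandroff_compactification
      topspace_euclidean_subtopology
    by metis
qed


section \<open>The Appert space\<close>

definition appert_count :: "nat \<Rightarrow> nat set \<Rightarrow> nat" where
  "appert_count n E = card {m \<in> E. m \<le> n}"

definition appert_open :: "nat set \<Rightarrow> bool" where
  "appert_open E \<longleftrightarrow> E \<subseteq> {0<..} \<and>
     (1 \<notin> E \<or> 1 \<in> E \<and> (\<lambda>n. real (appert_count n E) / real n) \<longlonglongrightarrow> 1)"

definition appert_space :: "nat topology" where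
  "appert_space = topology appert_open"

lemma openin_appert_space: "openin appert_space = appert_open"
proof -
  have le: "appert_count n E \<le> n" if "E \<subseteq> {0<..}" for n E
  proof -
    have "card {m \<in> E. m \<le> n} \<le> card {0<..n}"
      using that by (intro card_mono) auto
    then show ?thesis by (simp add: appert_count_def)
  qed
  have le1: "real (appert_count n E) / real n \<le> 1" if "E \<subseteq> {0<..}" for n E
    using le[OF that, of n] by (simp add: divide_le_eq)
  have mono: "appert_count n E \<le> appert_count n F" if "E \<subseteq> F" for n E F
    unfolding appert_count_def using that by (intro card_mono) auto
  have int: "appert_open (S \<inter> T)" if "appert_open S" "appert_open T" for S T
  proof (cases "1 \<in> S \<inter> T")
    case False
    then show ?thesis using that by (auto simp: appert_open_def)
  next
    case True
    let ?d = "\<lambda>E n. real (appert_count n E) / real n"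
    from True that have lim: "?d S \<longlonglongrightarrow> 1" "?d T \<longlonglongrightarrow> 1" and sub: "S \<subseteq> {0<..}" "T \<subseteq> {0<..}"
      by (auto simp: appert_open_def)
    have "?d S n + ?d T n - 1 \<le> ?d (S \<inter> T) n" for n
    proof -
      have "{m \<in> S. m \<le> n} \<inter> {m \<in> T. m \<le> n} = {m \<in> S \<inter> T. m \<le> n}"
           "{m \<in> S. m \<le> n} \<union> {m \<in> T. m \<le> n} = {m \<in> S \<union> T. m \<le> n}"
        by auto
      then have "appert_count n S + appert_count n T =
          appert_count n (S \<union> T) + appert_count n (S \<inter> T)"
        using card_Un_Int[of "{m \<in> S. m \<le> n}" "{m \<in> T. m \<le> n}"]
        by (simp add: appert_count_def)
      then have "?d S n + ?d T n = ?d (S \<union> T) n + ?d (S \<inter> T) n"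
        by (metis add_divide_distrib of_nat_add)
      then show ?thesis
        using le1[of "S \<union> T" n] sub by simp
    qed
    moreover have "(\<lambda>n. ?d S n + ?d T n - 1) \<longlonglongrightarrow> 1"
      using tendsto_diff[OF tendsto_add[OF lim] tendsto_const[of 1]] by simp
    moreover have "?d (S \<inter> T) n \<le> 1" for n
      using le1 sub by blast
    ultimately have "?d (S \<inter> T) \<longlonglongrightarrow> 1"
      using tendsto_sandwich[of "\<lambda>n. ?d S n + ?d T n - 1" "?d (S \<inter> T)" sequentially "\<lambda>_. 1" 1]
      by simp
    then show ?thesis
      using True sub by (auto simp: appert_open_def)
  qed
  have un: "appert_open (\<Union>\<K>)" if \<K>: "\<forall>K\<in>\<K>. appert_open K" for \<K>
  proof (cases "1 \<in> \<Union>\<K>")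
    case False
    then show ?thesis using \<K> by (auto simp: appert_open_def)
  next
    case True
    let ?d = "\<lambda>E n. real (appert_count n E) / real n"
    from True obtain K where K: "K \<in> \<K>" "1 \<in> K" by blast
    with \<K> have lim: "?d K \<longlonglongrightarrow> 1"
      by (auto simp: appert_open_def)
    have sub: "\<Union>\<K> \<subseteq> {0<..}"
      using \<K> by (auto simp: appert_open_def)
    have "?d K n \<le> ?d (\<Union>\<K>) n" for n
      using mono[of K "\<Union>\<K>" n] K by (intro divide_right_mono) auto
    moreover have "?d (\<Union>\<K>) n \<le> 1" for n
      using le1 sub by blast
    ultimately have "?d (\<Union>\<K>) \<longlonglongrightarrow> 1"
      using tendsto_sandwich[of "?d K" "?d (\<Union>\<K>)" sequentially "\<lambda>_. 1" 1] lim by simp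
    then show ?thesis
      using True sub unfolding appert_open_def by blast
  qed
  have "istopology appert_open"
    unfolding istopology_def using int un by blast
  then show ?thesis
    by (simp add: appert_space_def topology_inverse')
qed

lemma topspace_appert_space: "topspace appert_space = {0<..}"
proof -
  have "appert_count n {0<..} = n" for n
  proof -
    have "{m \<in> {0<..}. m \<le> n} = {0<..n}" by auto
    then show ?thesis by (simp add: appert_count_def)
  qed
  then have "(\<lambda>n. real (appert_count n {0<..}) / real n) \<longlonglongrightarrow> 1"
    by (auto intro!: tendsto_eventually eventually_sequentiallyI[of 1])
  then have "openin appert_space {0<..}"
    by (simp add: openin_appert_space appert_open_def)
  moreover have "topspace appert_space \<subseteq> {0<..}"
    using openin_topspace[of appert_space] by (simp add: openin_appert_space appert_open_def)
  ultimately show ?thesis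
    by (meson openin_subset subset_antisym)
qed

end

theory Submission
  imports Defs "HOL-Real_Asymp.Real_Asymp"
begin

text \<open>
  All four spaces are countable, and each has a point without a countable neighbourhood base. The
  theorem therefore follows once a countable topological space definable in an o-minimal structure
  is known to be second countable. If the universe is countable this is clear, since the basis is
  then indexed by countably many parameters. The universe may be uncountable, however, and the
  substance of the proof is that uncountably many parameters still carve only countably many
  sets out of a countable definable set (\<open>countable_traces\<close>).

  Let \<open>A\<close> be a countable definable set, let \<open>P a b c\<close> be a definable condition on \<open>a \<in> A\<close> and
  parameters \<open>(b, c)\<close>, and let \<open>X(a, b) = {c. P a b c}\<close>. By induction on the number of parameters,
  it is enough to find countably many definable conditions on \<open>a\<close> and \<open>b\<close> alone such that each
  trace \<open>{a \<in> A. P a b c}\<close> is given by one of them. By o-minimality \<open>X(a, b)\<close> has a finite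
  boundary and is constant between boundary points. Put
  \<open>F(b) = (\<Union>a\<in>A. boundary of X(a, b))\<close>. This is a definable subset of the line, so it has a
  finite boundary too.

  If \<open>c \<in> F(b)\<close>, then \<open>c\<close> is the \<open>i\<close>-th boundary point of \<open>X(a\<^sub>0, b)\<close> for some \<open>i\<close> and some
  \<open>a\<^sub>0 \<in> A\<close>. There are only countably many pairs \<open>(a\<^sub>0, i)\<close>, and for each of them \<open>c\<close> is
  definable from \<open>b\<close>. The same holds if \<open>c\<close> is the \<open>i\<close>-th boundary point of \<open>F(b)\<close>. Otherwise \<open>c\<close>
  lies in an interval disjoint from \<open>F(b)\<close>, on which every \<open>X(a, b)\<close> is constant, so \<open>c\<close> can be
  replaced by the germ just to the right of the preceding boundary point of \<open>F(b)\<close>, or by the germ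
  at \<open>-\<infinity>\<close> if there is no such point. The number \<open>i\<close> need not be bounded as \<open>b\<close> varies: it is
  a natural number, and countably many conditions are allowed.

  The failure of first countability is in each case a diagonal argument: pick \<open>g k\<close> in the
  \<open>k\<close>-th member of a supposed countable base at the point, so far out that removing the whole
  range of \<open>g\<close> leaves a neighbourhood of the point.
\<close>

section \<open>Families definable with parameters\<close>

fun rename_term :: "(nat \<Rightarrow> nat) \<Rightarrow> 'f fo_term \<Rightarrow> 'f fo_term" where
  "rename_term \<rho> (Var i) = Var (\<rho> i)"
| "rename_term \<rho> (App f ts) = App f (map (rename_term \<rho>) ts)"

lemma eval_rename_term: "eval_term M e (rename_term \<rho> t) = eval_term M (e \<circ> \<rho>) t"
  by (induction t) (auto simp: comp_def cong: map_cong)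

lemma wf_rename_term: "wf_term M (rename_term \<rho> t) = wf_term M t"
  by (induction t) auto

lemma eval_term_cong:
  "(\<And>i. i \<in> term_vars t \<Longrightarrow> e i = e' i) \<Longrightarrow> eval_term M e t = eval_term M e' t"
proof (induction t)
  case (App f ts)
  then have "map (eval_term M e) ts = map (eval_term M e') ts"
    by (intro map_cong) auto
  then show ?case by (simp only: eval_term.simps)
qed auto

lemma finite_term_vars: "finite (term_vars t)"
  by (induction t) auto

lemma finite_free_vars: "finite (free_vars \<phi>)"
  by (induction \<phi>) (auto simp: finite_term_vars)

lemma sat_cong:
  "(\<And>i. i \<in> free_vars \<phi> \<Longrightarrow> e i = e' i) \<Longrightarrow> sat M e \<phi> = sat M e' \<phi>"
proof (induction \<phi> arbitrary: e e')
  case (Eq s t)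
  then show ?case using eval_term_cong[of s e e' M] eval_term_cong[of t e e' M] by simp
next
  case (Less s t)
  then show ?case using eval_term_cong[of s e e' M] eval_term_cong[of t e e' M] by simp
next
  case (Pred r ts)
  then have "map (eval_term M e) ts = map (eval_term M e') ts"
    by (intro map_cong refl eval_term_cong) auto
  then show ?case by (simp only: sat.simps)
next
  case (Neg \<phi>)
  then show ?case by (metis free_vars.simps(4) sat.simps(4))
next
  case (Conj \<phi> \<psi>)
  have "sat M e \<phi> = sat M e' \<phi>" "sat M e \<psi> = sat M e' \<psi>"
    using Conj.prems by (auto intro!: Conj.IH)
  then show ?case by simp
next
  case (Exists i \<phi>)
  have "sat M (e(i := a)) \<phi> = sat M (e'(i := a)) \<phi>" for a
    using Exists.prems by (auto intro!: Exists.IH)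
  then show ?case by simp
qed

text \<open>The map \<open>\<rho>\<close> may identify variables: bound variables are renamed along the way, which is why
  the renamed formula is only asserted to exist.\<close>

lemma rename_form_exists:
  assumes "wf_form M \<phi>"
  shows "\<exists>\<phi>'. wf_form M \<phi>' \<and> (\<forall>e. sat M e \<phi>' = sat M (e \<circ> \<rho>) \<phi>)"
  using assms
proof (induction \<phi> arbitrary: \<rho>)
  case (Eq s t)
  then show ?case
    by (intro exI[of _ "Eq (rename_term \<rho> s) (rename_term \<rho> t)"])
      (simp add: wf_rename_term eval_rename_term comp_def)
next
  case (Less s t)
  then show ?case
    by (intro exI[of _ "Less (rename_term \<rho> s) (rename_term \<rho> t)"])
      (simp add: wf_rename_term eval_rename_term comp_def)
next
  case (Pred r ts)
  have "map (eval_term M e) (map (rename_term \<rho>) ts) = map (eval_term M (e \<circ> \<rho>)) ts" for e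
    by (simp add: eval_rename_term)
  with Pred show ?case
    by (intro exI[of _ "Pred r (map (rename_term \<rho>) ts)"])
      (simp add: wf_rename_term comp_def del: map_map)
next
  case (Neg \<phi>)
  then show ?case by (metis sat.simps(4) wf_form.simps(4))
next
  case (Conj \<phi> \<psi>)
  then show ?case by (metis sat.simps(5) wf_form.simps(5))
next
  case (Exists i \<phi>)
  \<comment> \<open>A bound variable outside the image of the free ones cannot capture any of them.\<close>
  obtain z where z: "z \<notin> \<rho> ` free_vars \<phi>"
    using ex_new_if_finite[OF infinite_UNIV_nat finite_imageI[OF finite_free_vars]] by blast
  obtain \<phi>' where \<phi>': "wf_form M \<phi>'" "\<And>e. sat M e \<phi>' = sat M (e \<circ> \<rho>(i := z)) \<phi>"
    using Exists by (metis wf_form.simps(6))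
  have "sat M (e(z := a) \<circ> \<rho>(i := z)) \<phi> = sat M ((e \<circ> \<rho>)(i := a)) \<phi>" for e a
    using z by (intro sat_cong) auto
  then show ?case
    using \<phi>' by (intro exI[of _ "Exists z \<phi>'"]) (simp add: comp_def)
qed

definition coord_terms :: "('e \<Rightarrow> 'm) set \<Rightarrow> ('e \<Rightarrow> 'm) set" where
  "coord_terms V = V \<union> range (\<lambda>c _. c)"

text \<open>The predicates \<open>P\<close> on a type \<open>'e\<close> of tuples that are definable with parameters, where \<open>V\<close>
  collects the coordinate functions of the tuples. Substituting coordinates or constants for the
  variables of one formula turns pulling back along a coordinate map into composition of
  functions; with \<open>'e\<close> polymorphic, a quantifier just pairs \<open>'e\<close> with the bound value, and
  variable names do not occur.\<close>

definition definable_over ::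
  "('f, 'r, 'm::linorder) fo_struct \<Rightarrow> ('e \<Rightarrow> 'm) set \<Rightarrow> ('e \<Rightarrow> bool) \<Rightarrow> bool" where
  "definable_over M V P \<longleftrightarrow>
     (\<exists>\<phi> t. wf_form M \<phi> \<and> (\<forall>i. t i \<in> coord_terms V) \<and> (\<forall>e. P e \<longleftrightarrow> sat M (\<lambda>i. t i e) \<phi>))"

definition pair_coords :: "('e \<Rightarrow> 'm) set \<Rightarrow> ('d \<Rightarrow> 'm) set \<Rightarrow> ('e \<times> 'd \<Rightarrow> 'm) set"
  (infixr "\<oplus>\<^sub>c" 70) where
  "V \<oplus>\<^sub>c W = (\<lambda>v p. v (fst p)) ` V \<union> (\<lambda>w p. w (snd p)) ` W"

text \<open>Substitutions that send coordinates to coordinates or constants; definability is preserved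
  by composition with them.\<close>

definition coord_map :: "('e \<Rightarrow> 'm) set \<Rightarrow> ('d \<Rightarrow> 'm) set \<Rightarrow> ('e \<Rightarrow> 'd) \<Rightarrow> bool" where
  "coord_map V W g \<longleftrightarrow> (\<forall>w\<in>W. (\<lambda>e. w (g e)) \<in> coord_terms V)"

lemma coord_term_const: "(\<lambda>_. c) \<in> coord_terms V"
  by (auto simp: coord_terms_def)

lemma coord_term_base: "v \<in> V \<Longrightarrow> v \<in> coord_terms V"
  by (auto simp: coord_terms_def)

lemma coord_term_fst: "t \<in> coord_terms V \<Longrightarrow> (\<lambda>p. t (fst p)) \<in> coord_terms (V \<oplus>\<^sub>c W)"
  by (auto simp: coord_terms_def pair_coords_def)

lemma coord_term_snd: "t \<in> coord_terms W \<Longrightarrow> (\<lambda>p. t (snd p)) \<in> coord_terms (V \<oplus>\<^sub>c W)"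
  by (auto simp: coord_terms_def pair_coords_def)

lemma coord_term_last: "(\<lambda>p. snd p) \<in> coord_terms (V \<oplus>\<^sub>c {\<lambda>c. c})"
  by (auto simp: coord_terms_def pair_coords_def)

lemma coord_map_term:
  "coord_map V W g \<Longrightarrow> t \<in> coord_terms W \<Longrightarrow> (\<lambda>e. t (g e)) \<in> coord_terms V"
  by (auto simp: coord_terms_def coord_map_def)

lemma coord_map_id: "coord_map V V (\<lambda>e. e)"
  by (auto simp: coord_terms_def coord_map_def)

lemma coord_map_const: "coord_map V W (\<lambda>_. b)"
  by (auto simp: coord_terms_def coord_map_def)

lemma coord_map_one: "t \<in> coord_terms V \<Longrightarrow> coord_map V {\<lambda>c. c} t"
  by (auto simp: coord_map_def)

lemma coord_map_fst: "coord_map V W g \<Longrightarrow> coord_map (V \<oplus>\<^sub>c U) W (\<lambda>p. g (fst p))"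
  by (auto simp: coord_map_def dest!: bspec intro: coord_term_fst)

lemma coord_map_snd: "coord_map U W g \<Longrightarrow> coord_map (V \<oplus>\<^sub>c U) W (\<lambda>p. g (snd p))"
  by (auto simp: coord_map_def dest!: bspec intro: coord_term_snd)

lemma coord_map_Pair:
  "coord_map V W g \<Longrightarrow> coord_map V U h \<Longrightarrow> coord_map V (W \<oplus>\<^sub>c U) (\<lambda>e. (g e, h e))"
  by (auto simp: coord_map_def pair_coords_def)

lemma definable_pullback:
  assumes "definable_over M W P" "coord_map V W g"
  shows "definable_over M V (\<lambda>e. P (g e))"
proof -
  obtain \<phi> t where *: "wf_form M \<phi>" "\<And>i. t i \<in> coord_terms W" "\<And>e. P e \<longleftrightarrow> sat M (\<lambda>i. t i e) \<phi>"
    using assms(1) unfolding definable_over_def by blast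
  then show ?thesis
    unfolding definable_over_def
    by (intro exI[of _ \<phi>] exI[of _ "\<lambda>i e. t i (g e)"]) (auto intro: coord_map_term[OF assms(2)])
qed

text \<open>A definable predicate sees only the coordinates in \<open>V\<close>. This matters because tuples are
  coded below as functions on all natural numbers, of which only finitely many values are
  coordinates.\<close>

lemma definable_over_cong:
  assumes "definable_over M V P" "\<And>v. v \<in> V \<Longrightarrow> v e = v e'"
  shows "P e = P e'"
proof -
  obtain \<phi> t where *: "\<And>i. t i \<in> coord_terms V" "\<And>e. P e \<longleftrightarrow> sat M (\<lambda>i. t i e) \<phi>"
    using assms(1) unfolding definable_over_def by blast
  have "t i e = t i e'" for i
    using *(1)[of i] assms(2) by (auto simp: coord_terms_def)
  then show ?thesis by (simp add: *(2))
qed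

lemma definable_less:
  "s \<in> coord_terms V \<Longrightarrow> t \<in> coord_terms V \<Longrightarrow> definable_over M V (\<lambda>e. s e < t e)"
  unfolding definable_over_def
  by (rule exI[of _ "Less (Var 0) (Var 1)"], rule exI[of _ "\<lambda>i. if i = 0 then s else t"]) auto

lemma definable_not: "definable_over M V P \<Longrightarrow> definable_over M V (\<lambda>e. \<not> P e)"
  unfolding definable_over_def by (metis sat.simps(4) wf_form.simps(4))

lemma definable_conj:
  assumes "definable_over M V P" "definable_over M V Q"
  shows "definable_over M V (\<lambda>e. P e \<and> Q e)"
proof -
  obtain \<phi> s where s: "wf_form M \<phi>" "\<And>i. s i \<in> coord_terms V" "\<And>e. P e \<longleftrightarrow> sat M (\<lambda>i. s i e) \<phi>"
    using assms(1) unfolding definable_over_def by blast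
  obtain \<psi> t where t: "wf_form M \<psi>" "\<And>i. t i \<in> coord_terms V" "\<And>e. Q e \<longleftrightarrow> sat M (\<lambda>i. t i e) \<psi>"
    using assms(2) unfolding definable_over_def by blast
  \<comment> \<open>The variables of the two formulas are kept apart as even and odd ones.\<close>
  obtain \<phi>' where \<phi>': "wf_form M \<phi>'" "\<And>e. sat M e \<phi>' = sat M (e \<circ> (\<lambda>i. 2 * i)) \<phi>"
    using rename_form_exists[OF s(1)] by metis
  obtain \<psi>' where \<psi>': "wf_form M \<psi>'" "\<And>e. sat M e \<psi>' = sat M (e \<circ> (\<lambda>i. 2 * i + 1)) \<psi>"
    using rename_form_exists[OF t(1)] by metis
  define u where "u i = (if even i then s (i div 2) else t (i div 2))" for i
  have "(\<lambda>i. u i e) \<circ> (\<lambda>i. 2 * i) = (\<lambda>i. s i e)" "(\<lambda>i. u i e) \<circ> (\<lambda>i. 2 * i + 1) = (\<lambda>i. t i e)" for e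
    by (auto simp: u_def)
  then have "\<forall>e. P e \<and> Q e \<longleftrightarrow> sat M (\<lambda>i. u i e) (Conj \<phi>' \<psi>')"
    using s(3) t(3) \<phi>'(2) \<psi>'(2) by simp
  moreover have "\<forall>i. u i \<in> coord_terms V"
    by (simp add: u_def s(2) t(2))
  ultimately show ?thesis
    unfolding definable_over_def using \<phi>'(1) \<psi>'(1) by (metis wf_form.simps(5))
qed

text \<open>The last coordinate may have been substituted for many variables; identifying these gives
  it a single variable, which can then be quantified or be left as the only free one.\<close>

lemma definable_over_last_coord:
  assumes "definable_over M (V \<oplus>\<^sub>c {\<lambda>c. c}) Q"
  obtains \<phi> s where "wf_form M \<phi>" "\<And>i. s i \<in> coord_terms V"
    "\<And>e c. Q (e, c) \<longleftrightarrow> sat M (case_nat c (\<lambda>i. s i e)) \<phi>"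
proof -
  obtain \<phi> t where t: "wf_form M \<phi>" "\<And>i. t i \<in> coord_terms (V \<oplus>\<^sub>c {\<lambda>c. c})"
      "\<And>p. Q p \<longleftrightarrow> sat M (\<lambda>i. t i p) \<phi>"
    using assms(1) unfolding definable_over_def by blast
  obtain \<phi>' where \<phi>': "wf_form M \<phi>'"
      "\<And>e. sat M e \<phi>' = sat M (e \<circ> (\<lambda>i. if t i = snd then 0 else Suc i)) \<phi>"
    using rename_form_exists[OF t(1)] by metis
  \<comment> \<open>A term \<open>t i\<close> other than \<open>snd\<close> ignores the last coordinate, so any value may be put there.\<close>
  define s where "s i e = (if t i = snd then undefined else t i (e, undefined))" for i e
  have cases: "t i = snd \<or> (\<exists>v\<in>coord_terms V. t i = (\<lambda>p. v (fst p)))" for i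
    using t(2)[of i] by (fastforce simp: coord_terms_def pair_coords_def)
  have si: "s i \<in> coord_terms V \<and> (t i = snd \<or> t i = (\<lambda>p. s i (fst p)))" for i
  proof (cases "t i = snd")
    case True
    then have "s i = (\<lambda>_. undefined)" by (simp add: s_def[abs_def])
    with True show ?thesis by (simp add: coord_term_const)
  next
    case False
    then obtain v where v: "v \<in> coord_terms V" "t i = (\<lambda>p. v (fst p))"
      using cases[of i] by blast
    with False have "s i = v" by (simp add: s_def[abs_def])
    with v show ?thesis by simp
  qed
  have "case_nat c (\<lambda>i. s i e) \<circ> (\<lambda>i. if t i = snd then 0 else Suc i) = (\<lambda>i. t i (e, c))" for e c
  proof
    fix i
    show "(case_nat c (\<lambda>i. s i e) \<circ> (\<lambda>i. if t i = snd then 0 else Suc i)) i = t i (e, c)"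
      using si[of i] by (cases "t i = snd") (auto dest: fun_cong[where x = "(e, c)"])
  qed
  then show thesis
    using that[of \<phi>' s] \<phi>' t(3) si by simp
qed

lemma definable_ex:
  assumes "definable_over M (V \<oplus>\<^sub>c {\<lambda>c. c}) (\<lambda>p. Q (fst p) (snd p))"
  shows "definable_over M V (\<lambda>e. \<exists>c. Q e c)"
proof -
  obtain \<phi> s where s: "wf_form M \<phi>" "\<And>i. s i \<in> coord_terms V"
      "\<And>e c. Q e c \<longleftrightarrow> sat M (case_nat c (\<lambda>i. s i e)) \<phi>"
    using definable_over_last_coord[OF assms] by (metis fst_conv snd_conv)
  define u where "u = case_nat (\<lambda>_. undefined) s"
  have "(\<lambda>i. u i e)(0 := c) = case_nat c (\<lambda>i. s i e)" for e c
    by (auto simp: u_def fun_eq_iff split: nat.splits)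
  moreover have "u i \<in> coord_terms V" for i
    by (auto simp: u_def s(2) coord_term_const split: nat.splits)
  ultimately show ?thesis
    unfolding definable_over_def using s
    by (intro exI[of _ "Exists 0 \<phi>"] exI[of _ u]) auto
qed

lemma definable_imp:
  assumes "definable_over M V P" "definable_over M V Q"
  shows "definable_over M V (\<lambda>e. P e \<longrightarrow> Q e)"
  using definable_not[OF definable_conj[OF assms(1) definable_not[OF assms(2)]]] by simp

lemma definable_iff:
  assumes "definable_over M V P" "definable_over M V Q"
  shows "definable_over M V (\<lambda>e. P e \<longleftrightarrow> Q e)"
  using definable_conj[OF definable_imp[OF assms] definable_imp[OF assms(2,1)]]
  by (simp add: iff_conv_conj_imp)

lemma definable_le:
  "s \<in> coord_terms V \<Longrightarrow> t \<in> coord_terms V \<Longrightarrow> definable_over M V (\<lambda>e. s e \<le> t e)"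
  using definable_not[OF definable_less] by (simp add: not_less)

lemma definable_all:
  assumes "definable_over M (V \<oplus>\<^sub>c {\<lambda>c. c}) (\<lambda>p. Q (fst p) (snd p))"
  shows "definable_over M V (\<lambda>e. \<forall>c. Q e c)"
  using definable_not[OF definable_ex[OF definable_not[OF assms]]] by simp

definition coords_of :: "nat set \<Rightarrow> ((nat \<Rightarrow> 'm) \<Rightarrow> 'm) set" where
  "coords_of I = (\<lambda>i a. a i) ` I"

lemma coord_map_fun_upd:
  "coord_map ((V \<oplus>\<^sub>c coords_of I) \<oplus>\<^sub>c {\<lambda>c. c}) (coords_of (insert j I))
     (\<lambda>p. (snd (fst p))(j := snd p))"
proof -
  have "(\<lambda>p. ((snd (fst p))(j := snd p)) i) \<in> coord_terms ((V \<oplus>\<^sub>c coords_of I) \<oplus>\<^sub>c {\<lambda>c. c})"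
    if i: "i \<in> insert j I" for i
  proof (cases "i = j")
    case True
    then show ?thesis by (simp add: coord_term_last)
  next
    case False
    with i have "(\<lambda>a. a i) \<in> coords_of I" by (auto simp: coords_of_def)
    then have "(\<lambda>p. snd (fst p) i) \<in> coord_terms ((V \<oplus>\<^sub>c coords_of I) \<oplus>\<^sub>c {\<lambda>c. c})"
      by (intro coord_term_fst coord_term_snd[where t = "\<lambda>a. a i"] coord_term_base)
    then show ?thesis using False by simp
  qed
  then show ?thesis
    unfolding coord_map_def coords_of_def by blast
qed

text \<open>Quantification over \<open>M\<close> to the power \<open>I\<close>, one coordinate at a time: the values of \<open>a\<close>
  outside \<open>I\<close> are irrelevant, so quantifying over the whole function is harmless.\<close>

lemma definable_ex_block:
  assumes "finite I" "definable_over M (V \<oplus>\<^sub>c coords_of I) (\<lambda>p. Q (fst p) (snd p))"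
  shows "definable_over M V (\<lambda>e. \<exists>a. Q e a)"
  using assms
proof (induction I arbitrary: Q)
  case empty
  have "coord_map V (V \<oplus>\<^sub>c coords_of {}) (\<lambda>e. (e, a))" for a
    by (intro coord_map_Pair coord_map_id coord_map_const)
  from definable_pullback[OF empty.prems this]
  have "definable_over M V (\<lambda>e. Q e undefined)" by simp
  moreover have "Q e a \<longleftrightarrow> Q e undefined" for e a
    using definable_over_cong[OF empty.prems, of "(e, a)" "(e, undefined)"]
    by (force simp: pair_coords_def coords_of_def)
  moreover from this have "(\<lambda>e. \<exists>a. Q e a) = (\<lambda>e. Q e undefined)"
    by (intro ext iffI exI[of _ undefined]) auto
  ultimately show ?case by simp
next
  case (insert j I)
  let ?g = "\<lambda>p :: (_ \<times> (nat \<Rightarrow> _)) \<times> _. (fst (fst p), (snd (fst p))(j := snd p))"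
  have "coord_map ((V \<oplus>\<^sub>c coords_of I) \<oplus>\<^sub>c {\<lambda>c. c}) (V \<oplus>\<^sub>c coords_of (insert j I)) ?g"
    by (intro coord_map_Pair coord_map_fst coord_map_id coord_map_fun_upd)
  from definable_pullback[OF insert.prems this]
  have "definable_over M (V \<oplus>\<^sub>c coords_of I) (\<lambda>p. \<exists>c. Q (fst p) ((snd p)(j := c)))"
    by (intro definable_ex) (simp add: fun_upd_def)
  then have "definable_over M V (\<lambda>e. \<exists>a c. Q e (a(j := c)))"
    by (rule insert.IH)
  moreover have "(\<exists>a c. Q e (a(j := c))) \<longleftrightarrow> (\<exists>a. Q e a)" for e
    by (metis fun_upd_triv)
  ultimately show ?case by simp
qed

section \<open>Unary sets in an o-minimal structure\<close>

text \<open>The topological boundary in the order topology, in a first-order form, so that it can be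
  taken definably in families.\<close>

definition order_boundary :: "'m::linorder set \<Rightarrow> 'm set" where
  "order_boundary X =
     {c. \<not> (\<exists>l r. l < c \<and> c < r \<and> (\<forall>d. l < d \<longrightarrow> d < r \<longrightarrow> (d \<in> X \<longleftrightarrow> c \<in> X)))}"

definition changes_only_at :: "'m::linorder set \<Rightarrow> 'm set \<Rightarrow> bool" where
  "changes_only_at F X \<longleftrightarrow> (\<forall>x y. x \<le> y \<longrightarrow> {x..y} \<inter> F = {} \<longrightarrow> (x \<in> X \<longleftrightarrow> y \<in> X))"

definition tame :: "'m::linorder set \<Rightarrow> bool" where
  "tame X \<longleftrightarrow> finite (order_boundary X) \<and> changes_only_at (order_boundary X) X"

lemma changes_only_atD:
  assumes "changes_only_at F X" "{min x y..max x y} \<inter> F = {}"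
  shows "x \<in> X \<longleftrightarrow> y \<in> X"
  using assms unfolding changes_only_at_def
  by (metis linorder_linear max.absorb1 max.absorb2 min.absorb1 min.absorb2)

lemma ex_gap_around:
  fixes c :: "'m::unbounded_dense_linorder"
  assumes "finite F"
  shows "\<exists>l r. l < c \<and> c < r \<and> {l<..<r} \<inter> F \<subseteq> {c}"
  using assms
proof induction
  case empty
  show ?case using lt_ex[of c] gt_ex[of c] by auto
next
  case (insert a F)
  then obtain l r where "l < c" "c < r" "{l<..<r} \<inter> F \<subseteq> {c}" by blast
  then have lr: "l < c" "c < r" "\<forall>x\<in>F. l < x \<longrightarrow> x < r \<longrightarrow> x = c" by auto
  show ?case
  proof (cases "a < c")
    case True
    then show ?thesis using lr by - (rule exI[of _ "max l a"], rule exI[of _ r], auto)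
  next
    case False
    show ?thesis
    proof (cases "a = c")
      case True
      then show ?thesis using lr by - (rule exI[of _ l], rule exI[of _ r], auto)
    next
      case False
      then show ?thesis
        using lr \<open>\<not> a < c\<close> by - (rule exI[of _ l], rule exI[of _ "min r a"], auto)
    qed
  qed
qed

lemma order_boundary_subset:
  fixes X :: "'m::unbounded_dense_linorder set"
  assumes "finite F" "changes_only_at F X"
  shows "order_boundary X \<subseteq> F"
proof
  fix c assume c: "c \<in> order_boundary X"
  show "c \<in> F"
  proof (rule ccontr)
    assume "c \<notin> F"
    obtain l r where lr: "l < c" "c < r" "{l<..<r} \<inter> F \<subseteq> {c}"
      using ex_gap_around[OF assms(1)] by blast
    have "d \<in> X \<longleftrightarrow> c \<in> X" if "l < d" "d < r" for d
    proof (rule changes_only_atD[OF assms(2)])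
      have "{min d c..max d c} \<subseteq> {l<..<r}"
        using lr that by (auto simp: min_def max_def split: if_splits)
      then show "{min d c..max d c} \<inter> F = {}"
        using lr(3) \<open>c \<notin> F\<close> by blast
    qed
    with c lr(1,2) show False unfolding order_boundary_def by blast
  qed
qed

text \<open>Away from its boundary a set is locally constant, so the intervals on both sides of a
  superfluous change point can be glued. Density of the order provides the points next to \<open>f\<close>
  through which the membership is passed on.\<close>

lemma changes_only_at_remove:
  fixes X :: "'m::unbounded_dense_linorder set"
  assumes "finite F" "changes_only_at F X" "f \<notin> order_boundary X"
  shows "changes_only_at (F - {f}) X"
  unfolding changes_only_at_def
proof (intro allI impI)
  fix x y assume xy: "x \<le> y" "{x..y} \<inter> (F - {f}) = {}"
  obtain l r where lr: "l < f" "f < r" "\<And>d. l < d \<Longrightarrow> d < r \<Longrightarrow> d \<in> X \<longleftrightarrow> f \<in> X"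
    using assms(3) unfolding order_boundary_def by blast
  have near: "z \<in> X \<longleftrightarrow> f \<in> X" if "f \<in> {x..y}" "z \<in> {x..y}" for z
  proof (cases "z < f")
    case True
    obtain w where w: "max z l < w" "w < f" using dense[of "max z l" f] True lr by auto
    have "{z..w} \<subseteq> {x..y} - {f}" using w that by auto
    then have "{z..w} \<inter> F = {}" using xy(2) by blast
    moreover have "z \<le> w" using w(1) by (simp add: less_imp_le)
    ultimately have "z \<in> X \<longleftrightarrow> w \<in> X"
      using assms(2) unfolding changes_only_at_def by blast
    then show ?thesis using lr(3)[of w] w lr(2) by auto
  next
    case False
    show ?thesis
    proof (cases "z = f")
      case False
      with \<open>\<not> z < f\<close> have "f < z" by simp
      obtain w where w: "f < w" "w < min z r" using dense[of f "min z r"] \<open>f < z\<close> lr by auto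
      have "{w..z} \<subseteq> {x..y} - {f}" using w that by auto
      then have "{w..z} \<inter> F = {}" using xy(2) by blast
      moreover have "w \<le> z" using w(2) by (simp add: less_imp_le)
      ultimately have "w \<in> X \<longleftrightarrow> z \<in> X"
        using assms(2) unfolding changes_only_at_def by blast
      then show ?thesis using lr(3)[of w] w lr(1) by auto
    qed simp
  qed
  show "x \<in> X \<longleftrightarrow> y \<in> X"
  proof (cases "f \<in> {x..y}")
    case True
    then show ?thesis using near[of x] near[of y] xy(1) by auto
  next
    case False
    then have "{x..y} \<inter> F = {}" using xy(2) by blast
    then show ?thesis using assms(2) xy(1) unfolding changes_only_at_def by blast
  qed
qed

text \<open>Removing the superfluous points from a finite set of change points leaves exactly the
  boundary. Unlike an arbitrary such set, the boundary is definable from the set itself. This takes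
  the place of completeness of the order: a change between two points forces a boundary point
  between them.\<close>

lemma tameI:
  fixes X :: "'m::unbounded_dense_linorder set"
  assumes "finite F" "changes_only_at F X"
  shows "tame X"
proof -
  have "changes_only_at (F - G) X" if "finite G" "G \<inter> order_boundary X = {}" for G
    using that
  proof induction
    case (insert g G)
    have "F - insert g G = F - G - {g}" by blast
    then show ?case
      using insert assms(1) changes_only_at_remove[of "F - G" X g] by auto
  qed (simp add: assms)
  from this[of "F - order_boundary X"] assms(1)
  have "changes_only_at (F - (F - order_boundary X)) X" by blast
  moreover have "F - (F - order_boundary X) = order_boundary X"
    using order_boundary_subset[OF assms] by blast
  ultimately show ?thesis
    unfolding tame_def using finite_subset[OF order_boundary_subset[OF assms] assms(1)] by simp
qed

lemma point_or_interval_changes: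
  assumes "point_or_interval I"
  shows "\<exists>F. finite F \<and> changes_only_at F I"
proof -
  have "\<exists>a b. changes_only_at {a, b} I"
  proof -
    consider a where "I = {a}" | a b where "I = {a<..<b}" | b where "I = {..<b}"
      | a where "I = {a<..}" | "I = UNIV"
      using assms unfolding point_or_interval_def by blast
    then show ?thesis
    proof cases
      case (1 a) then show ?thesis by (intro exI[of _ a]) (auto simp: changes_only_at_def)
    next
      case (2 a b)
      then show ?thesis by - (rule exI[of _ a], rule exI[of _ b], auto simp: changes_only_at_def)
    next
      case (3 b) then show ?thesis by (intro exI[of _ b]) (auto simp: changes_only_at_def)
    next
      case (4 a) then show ?thesis by (intro exI[of _ a]) (auto simp: changes_only_at_def)
    qed (auto simp: changes_only_at_def)
  qed
  then show ?thesis by (metis finite.emptyI finite.insertI)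
qed

lemma changes_only_at_Union:
  assumes "finite \<I>" "\<And>I. I \<in> \<I> \<Longrightarrow> \<exists>F. finite F \<and> changes_only_at F I"
  shows "\<exists>F. finite F \<and> changes_only_at F (\<Union>\<I>)"
  using assms
proof induction
  case empty
  show ?case by (intro exI[of _ "{}"]) (simp add: changes_only_at_def)
next
  case (insert I \<I>)
  then obtain F G where "finite F" "finite G" "changes_only_at F I" "changes_only_at G (\<Union>\<I>)"
    by (metis insertCI)
  then show ?case
    by (intro exI[of _ "F \<union> G"]) (simp add: changes_only_at_def Int_Un_distrib)
qed

definition definable_family ::
  "('f, 'r, 'm::linorder) fo_struct \<Rightarrow> ('e \<Rightarrow> 'm) set \<Rightarrow> ('e \<Rightarrow> 'm set) \<Rightarrow> bool" where
  "definable_family M V X \<longleftrightarrow> definable_over M (V \<oplus>\<^sub>c {\<lambda>c. c}) (\<lambda>p. snd p \<in> X (fst p))"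

lemma tame_fibre:
  fixes M :: "('f, 'r, 'm::unbounded_dense_linorder) fo_struct"
  assumes "o_minimal M" "definable_family M V X"
  shows "tame (X e)"
proof -
  obtain \<phi> s where s: "wf_form M \<phi>" "\<And>e c. c \<in> X e \<longleftrightarrow> sat M (case_nat c (\<lambda>i. s i e)) \<phi>"
    using definable_over_last_coord[OF assms(2)[unfolded definable_family_def]]
    by (metis fst_conv snd_conv)
  obtain k where k: "free_vars \<phi> \<subseteq> {..<k}"
    using finite_nat_bounded[OF finite_free_vars] by blast
  define p where "p = map (\<lambda>i. s i e) [0..<k]"
  have "sat M (\<lambda>i. ([c] @ p) ! i) \<phi> = sat M (case_nat c (\<lambda>i. s i e)) \<phi>" for c
    using k by (intro sat_cong) (auto simp: p_def split: nat.splits)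
  then have "{a. [a] \<in> fibre M \<phi> {a. length a = 1} p} = X e"
    using s(2) by (auto simp: fibre_def)
  moreover have "definable_set M 1 (fibre M \<phi> {a. length a = 1} p)"
    unfolding definable_set_def partitioned_form_def
    using s(1) k by (intro exI[of _ \<phi>] exI[of _ k] exI[of _ p]) (auto simp: p_def)
  ultimately obtain \<I> where "finite \<I>" "\<forall>I\<in>\<I>. point_or_interval I" "X e = \<Union>\<I>"
    using assms(1) unfolding o_minimal_def by metis
  then show ?thesis
    using changes_only_at_Union[of \<I>] point_or_interval_changes tameI by metis
qed

lemma definable_mem:
  assumes "definable_family M W X" "t \<in> coord_terms V" "coord_map V W g"
  shows "definable_over M V (\<lambda>e. t e \<in> X (g e))"
  using definable_pullback[OF assms(1)[unfolded definable_family_def], of V "\<lambda>e. (g e, t e)"]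
    coord_map_Pair[OF assms(3) coord_map_one[OF assms(2)]] by simp

lemmas definable_rules =
  definable_not definable_conj definable_imp definable_iff definable_ex definable_all
  definable_less definable_le coord_term_last coord_term_fst coord_map_fst coord_map_id

lemma definable_family_order_boundary:
  assumes "definable_family M V X"
  shows "definable_family M V (\<lambda>e. order_boundary (X e))"
  unfolding definable_family_def order_boundary_def mem_Collect_eq
  by (rule definable_rules definable_mem[OF assms])+

text \<open>The \<open>i\<close>-th element of a finite set in increasing order, as a set with at most one element:
  stripping off the least element \<open>i\<close> times keeps it definable, by induction on \<open>i\<close>.\<close>

definition least_elems :: "'m::linorder set \<Rightarrow> 'm set" where
  "least_elems X = {c. c \<in> X \<and> (\<forall>d. d \<in> X \<longrightarrow> c \<le> d)}"

definition nonleast_elems :: "'m::linorder set \<Rightarrow> 'm set" where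
  "nonleast_elems X = {c. c \<in> X \<and> (\<exists>d. d \<in> X \<and> d < c)}"

definition nth_least :: "nat \<Rightarrow> 'm::linorder set \<Rightarrow> 'm set" where
  "nth_least i X = least_elems ((nonleast_elems ^^ i) X)"

text \<open>Hence every element of a finite definable set is itself definable from the same
  parameters.\<close>

lemma nth_least_exists:
  assumes "finite X" "c \<in> X"
  shows "\<exists>i. nth_least i X = {c}"
  using assms
proof (induction X rule: finite_psubset_induct)
  case (psubset X)
  show ?case
  proof (cases "c \<in> nonleast_elems X")
    case False
    with psubset.prems have "\<And>d. d \<in> X \<Longrightarrow> c \<le> d"
      by (auto simp: nonleast_elems_def not_less)
    with psubset.prems have "least_elems X = {c}"
      by (force simp: least_elems_def)
    then show ?thesis
      by (intro exI[of _ 0]) (simp add: nth_least_def)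
  next
    case True
    have "Min X \<in> X"
      using psubset.hyps psubset.prems by (intro Min_in) auto
    moreover have "Min X \<notin> nonleast_elems X"
      using Min_le[OF psubset.hyps] unfolding nonleast_elems_def mem_Collect_eq by (meson not_less)
    ultimately have "nonleast_elems X \<subset> X"
      by (auto simp: nonleast_elems_def)
    with psubset.IH True obtain i where "nth_least i (nonleast_elems X) = {c}" by blast
    then show ?thesis
      by (intro exI[of _ "Suc i"]) (simp add: nth_least_def funpow_swap1)
  qed
qed

lemma definable_family_least_elems:
  assumes "definable_family M V X"
  shows "definable_family M V (\<lambda>e. least_elems (X e))"
  unfolding definable_family_def least_elems_def mem_Collect_eq
  by (rule definable_rules definable_mem[OF assms])+

lemma definable_family_nonleast_elems:
  assumes "definable_family M V X"
  shows "definable_family M V (\<lambda>e. nonleast_elems (X e))"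
  unfolding definable_family_def nonleast_elems_def mem_Collect_eq
  by (rule definable_rules definable_mem[OF assms])+

lemma definable_family_nth_least:
  assumes "definable_family M V X"
  shows "definable_family M V (\<lambda>e. nth_least i (X e))"
proof -
  have "definable_family M V (\<lambda>e. (nonleast_elems ^^ i) (X e))"
    by (induction i) (simp_all add: assms definable_family_nonleast_elems)
  then show ?thesis
    unfolding nth_least_def by (rule definable_family_least_elems)
qed

definition right_germ :: "'m::linorder set \<Rightarrow> 'm set" where
  "right_germ X = {c. \<exists>r. c < r \<and> (\<forall>d. c < d \<longrightarrow> d < r \<longrightarrow> d \<in> X)}"

lemma definable_family_right_germ:
  assumes "definable_family M V X"
  shows "definable_family M V (\<lambda>e. right_germ (X e))"
  unfolding definable_family_def right_germ_def mem_Collect_eq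
  by (rule definable_rules definable_mem[OF assms])+

lemma definable_meets:
  assumes "definable_family M V X" "definable_family M V Y"
  shows "definable_over M V (\<lambda>e. \<exists>c. c \<in> X e \<and> c \<in> Y e)"
  by (rule definable_rules definable_mem[OF assms(1)] definable_mem[OF assms(2)])+

lemma definable_left_germ:
  assumes "definable_family M V X"
  shows "definable_over M V (\<lambda>e. \<exists>r. \<forall>d. d < r \<longrightarrow> d \<in> X e)"
  by (rule definable_rules definable_mem[OF assms])+

lemma definable_family_pullback:
  assumes "definable_family M W X" "coord_map V W g"
  shows "definable_family M V (\<lambda>e. X (g e))"
  unfolding definable_family_def
  by (rule definable_mem[OF assms(1)] coord_term_last coord_map_fst assms(2))+

section \<open>Countably many traces on a countable definable set\<close>

text \<open>If no boundary point lies in \<open>(e, c]\<close>, membership of \<open>c\<close> can be read off just to the right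
  of \<open>e\<close>, hence without mentioning \<open>c\<close>. The lemma after it is the case \<open>e = -\<infinity>\<close>.\<close>

lemma right_germ_eq:
  fixes X :: "'m::unbounded_dense_linorder set"
  assumes "tame X" "e < c" "\<And>d. e < d \<Longrightarrow> d \<le> c \<Longrightarrow> d \<notin> order_boundary X"
  shows "e \<in> right_germ X \<longleftrightarrow> c \<in> X"
proof -
  have const: "d \<in> X \<longleftrightarrow> c \<in> X" if "e < d" "d \<le> c" for d
  proof -
    have "{d..c} \<inter> order_boundary X = {}"
      using assms(3) that by fastforce
    then show ?thesis
      using assms(1) that(2) unfolding tame_def changes_only_at_def by blast
  qed
  show ?thesis
  proof
    assume "e \<in> right_germ X"
    then obtain r where r: "e < r" "\<And>d. e < d \<Longrightarrow> d < r \<Longrightarrow> d \<in> X"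
      unfolding right_germ_def by blast
    obtain d where "e < d" "d < min r c"
      using dense[of e "min r c"] r(1) assms(2) by auto
    then have d: "e < d" "d < r" "d < c" by simp_all
    show "c \<in> X" using r(2)[OF d(1,2)] const[OF d(1) less_imp_le[OF d(3)]] by blast
  next
    assume "c \<in> X"
    then show "e \<in> right_germ X"
      using const assms(2) less_imp_le unfolding right_germ_def by blast
  qed
qed

lemma left_germ_eq:
  fixes X :: "'m::unbounded_dense_linorder set"
  assumes "tame X" "\<And>d. d \<le> c \<Longrightarrow> d \<notin> order_boundary X"
  shows "(\<exists>r. \<forall>d. d < r \<longrightarrow> d \<in> X) \<longleftrightarrow> c \<in> X"
proof -
  have const: "d \<in> X \<longleftrightarrow> c \<in> X" if "d \<le> c" for d
  proof -
    have "{d..c} \<inter> order_boundary X = {}"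
      using assms(2) that by fastforce
    then show ?thesis
      using assms(1) that unfolding tame_def changes_only_at_def by blast
  qed
  show ?thesis
  proof
    assume "\<exists>r. \<forall>d. d < r \<longrightarrow> d \<in> X"
    then obtain r where r: "\<And>d. d < r \<Longrightarrow> d \<in> X" by blast
    obtain d where "d < min r c" using lt_ex by blast
    then have d: "d < r" "d < c" by simp_all
    show "c \<in> X" using r[OF d(1)] const[OF less_imp_le[OF d(2)]] by blast
  next
    assume "c \<in> X"
    then show "\<exists>r. \<forall>d. d < r \<longrightarrow> d \<in> X"
      using const less_imp_le by blast
  qed
qed

lemma nth_least_boundary:
  "tame X \<Longrightarrow> c \<in> order_boundary X \<Longrightarrow> \<exists>i. nth_least i (order_boundary X) = {c}"
  using nth_least_exists unfolding tame_def by blast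

text \<open>The set \<open>C\<close> contains a representative of each point of the definable set \<open>A\<close>, of which only
  the coordinates in \<open>I\<close> matter. Definability of \<open>A\<close> is essential: it makes the family \<open>F\<close>
  definable, whereas over the arbitrary countable set of rationals inside the reals every cut
  gives a trace of its own.

  In the induction step the parameter \<open>c\<close> with index \<open>j\<close> is eliminated. The set \<open>\<Psi>\<close> consists of
  the conditions that can replace \<open>P\<close>; none of them depends on \<open>c\<close>.\<close>

theorem countable_traces:
  fixes M :: "('f, 'r, 'm::unbounded_dense_linorder) fo_struct"
  assumes omin: "o_minimal M" and "finite K" and I: "finite I"
    and A: "definable_over M (coords_of I) A"
    and C: "countable C" "\<And>a. a \<in> C \<Longrightarrow> A a" "\<And>a. A a \<Longrightarrow> \<exists>a'\<in>C. \<forall>i\<in>I. a i = a' i"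
    and P: "definable_over M (coords_of I \<oplus>\<^sub>c coords_of K) P"
  shows "countable (range (\<lambda>b. {a \<in> C. P (a, b)}))"
  using \<open>finite K\<close> P
proof (induction K arbitrary: P)
  case empty
  have "P (a, b) \<longleftrightarrow> P (a, undefined)" for a b
    using definable_over_cong[OF empty.prems, of "(a, b)" "(a, undefined)"]
    by (force simp: pair_coords_def coords_of_def)
  then have "range (\<lambda>b. {a \<in> C. P (a, b)}) \<subseteq> {{a \<in> C. P (a, undefined)}}"
    by auto
  then show ?case
    by (rule countable_subset) simp
next
  case (insert j K)
  define X where "X = (\<lambda>p. {c. P (fst p, (snd p)(j := c))})"
  define F where "F b = {c. \<exists>a. A a \<and> c \<in> order_boundary (X (a, b))}" for b
  let ?V = "coords_of I \<oplus>\<^sub>c coords_of K"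
  have X: "definable_family M ?V X"
  proof -
    have "coord_map (?V \<oplus>\<^sub>c {\<lambda>c. c}) (coords_of (insert j K)) (\<lambda>p. (snd (fst p))(j := snd p))"
      by (rule coord_map_fun_upd)
    moreover have "coord_map (?V \<oplus>\<^sub>c {\<lambda>c. c}) (coords_of I) (\<lambda>p. fst (fst p))"
      by (rule coord_map_fst coord_map_id)+
    ultimately have "coord_map (?V \<oplus>\<^sub>c {\<lambda>c. c}) (coords_of I \<oplus>\<^sub>c coords_of (insert j K))
        (\<lambda>p. (fst (fst p), (snd (fst p))(j := snd p)))"
      by (rule coord_map_Pair[rotated])
    from definable_pullback[OF insert.prems this] show ?thesis
      by (simp add: definable_family_def X_def)
  qed
  have bX: "definable_family M ?V (\<lambda>p. order_boundary (X p))"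
    by (rule definable_family_order_boundary[OF X])
  have F: "definable_family M (coords_of K) F"
  proof -
    have "definable_over M ((coords_of K \<oplus>\<^sub>c {\<lambda>c. c}) \<oplus>\<^sub>c coords_of I)
        (\<lambda>p. A (snd p) \<and> snd (fst p) \<in> order_boundary (X (snd p, fst (fst p))))"
      by (rule definable_conj definable_pullback[OF A] definable_mem[OF bX] coord_map_Pair
          coord_map_snd coord_map_fst coord_map_id coord_term_fst coord_term_last)+
    then have "definable_over M (coords_of K \<oplus>\<^sub>c {\<lambda>c. c})
        (\<lambda>p. \<exists>a. A a \<and> snd p \<in> order_boundary (X (a, fst p)))"
      by (rule definable_ex_block[OF I])
    then show ?thesis by (simp add: definable_family_def F_def)
  qed
  have bF: "definable_family M ?V (\<lambda>p. order_boundary (F (snd p)))"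
    by (rule definable_family_pullback[OF definable_family_order_boundary[OF F]]
        coord_map_snd coord_map_id)+

  define \<Psi> where "\<Psi> =
      (\<lambda>(a, i) p. \<exists>c. c \<in> nth_least i (order_boundary (X (a, snd p))) \<and> c \<in> X p) ` (C \<times> UNIV) \<union>
      range (\<lambda>i p. \<exists>c. c \<in> nth_least i (order_boundary (F (snd p))) \<and> c \<in> X p) \<union>
      range (\<lambda>i p. \<exists>c. c \<in> nth_least i (order_boundary (F (snd p))) \<and> c \<in> right_germ (X p)) \<union>
      {\<lambda>p. \<exists>r. \<forall>d. d < r \<longrightarrow> d \<in> X p}"
  have "countable \<Psi>"
    unfolding \<Psi>_def using C(1) by (intro countable_Un countable_image countable_SIGMA) auto
  moreover have "countable (range (\<lambda>b. {a \<in> C. \<psi> (a, b)}))" if "\<psi> \<in> \<Psi>" for \<psi>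
  proof (rule insert.IH)
    have 1: "definable_family M ?V (\<lambda>p. order_boundary (X (a, snd p)))" for a
      by (rule definable_family_pullback[OF bX] coord_map_Pair coord_map_const coord_map_snd
          coord_map_id)+
    show "definable_over M ?V \<psi>"
      using that unfolding \<Psi>_def
      by (auto intro!: definable_meets definable_left_germ definable_family_nth_least
          definable_family_right_germ 1 X bF)
  qed
  ultimately have "countable (\<Union>\<psi>\<in>\<Psi>. range (\<lambda>b. {a \<in> C. \<psi> (a, b)}))"
    by (rule countable_UN)
  moreover have "range (\<lambda>b. {a \<in> C. P (a, b)}) \<subseteq> (\<Union>\<psi>\<in>\<Psi>. range (\<lambda>b. {a \<in> C. \<psi> (a, b)}))"
  proof (rule image_subsetI)
    fix b :: "nat \<Rightarrow> 'm"
    define c where "c = b j"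
    have tame_X: "tame (X p)" for p
      by (rule tame_fibre[OF omin X])
    have tame_F: "tame (F b)"
      by (rule tame_fibre[OF omin F])
    have P_iff: "P (a, b) \<longleftrightarrow> c \<in> X (a, b)" for a
      by (simp add: X_def c_def)
    have F_iff: "d \<in> F b \<longleftrightarrow> (\<exists>a\<in>C. d \<in> order_boundary (X (a, b)))" for d
    proof
      assume "d \<in> F b"
      then obtain a where a: "A a" "d \<in> order_boundary (X (a, b))" by (auto simp: F_def)
      then obtain a' where a': "a' \<in> C" "\<forall>i\<in>I. a i = a' i" using C(3) by blast
      have "P (a, b(j := c)) \<longleftrightarrow> P (a', b(j := c))" for c
        using a'(2) by (intro definable_over_cong[OF insert.prems])
          (auto simp: pair_coords_def coords_of_def)
      then have "X (a, b) = X (a', b)" by (simp add: X_def)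
      with a a' show "\<exists>a\<in>C. d \<in> order_boundary (X (a, b))" by auto
    qed (use C(2) in \<open>auto simp: F_def\<close>)
    have "\<exists>\<psi>\<in>\<Psi>. \<forall>a\<in>C. P (a, b) \<longleftrightarrow> \<psi> (a, b)"
    proof (cases "c \<in> F b")
      case True
      \<comment> \<open>This is where countability of \<open>C\<close> enters: \<open>a0\<close> becomes a constant of the condition.\<close>
      then obtain a0 where a0: "a0 \<in> C" "c \<in> order_boundary (X (a0, b))"
        using F_iff by blast
      then obtain i where "nth_least i (order_boundary (X (a0, b))) = {c}"
        using nth_least_boundary[OF tame_X a0(2)] by blast
      with a0(1) show ?thesis
        by (intro bexI[of _ "\<lambda>p. \<exists>c. c \<in> nth_least i (order_boundary (X (a0, snd p))) \<and> c \<in> X p"])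
          (auto simp: P_iff \<Psi>_def)
    next
      case notF: False
      show ?thesis
      proof (cases "c \<in> order_boundary (F b)")
        case True
        then obtain i where "nth_least i (order_boundary (F b)) = {c}"
          using nth_least_boundary[OF tame_F True] by blast
        then show ?thesis
          by (intro bexI[of _ "\<lambda>p. \<exists>c. c \<in> nth_least i (order_boundary (F (snd p))) \<and> c \<in> X p"])
            (auto simp: P_iff \<Psi>_def)
      next
        case not_bd: False
        \<comment> \<open>With no boundary point of \<open>F b\<close> between them, \<open>d\<close> lies outside \<open>F b\<close> like \<open>c\<close>.\<close>
        have no_bd: "d \<notin> order_boundary (X (a, b))"
          if "a \<in> C" "d \<le> c" "{d..c} \<inter> order_boundary (F b) = {}" for a d
        proof -
          have "d \<in> F b \<longleftrightarrow> c \<in> F b"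
            using tame_F that(2,3) by (simp add: tame_def changes_only_at_def)
          then show ?thesis using notF F_iff that(1) by blast
        qed
        let ?G = "{d \<in> order_boundary (F b). d < c}"
        show ?thesis
        proof (cases "?G = {}")
          case True
          have "{d..c} \<inter> order_boundary (F b) = {}" for d
            using True not_bd by (auto simp: order.order_iff_strict)
          then have "P (a, b) \<longleftrightarrow> (\<exists>r. \<forall>d. d < r \<longrightarrow> d \<in> X (a, b))" if "a \<in> C" for a
            using left_germ_eq[OF tame_X no_bd] that by (simp add: P_iff)
          then show ?thesis
            by (intro bexI[of _ "\<lambda>p. \<exists>r. \<forall>d. d < r \<longrightarrow> d \<in> X p"]) (auto simp: \<Psi>_def)
        next
          case False
          define e where "e = Max ?G"
          have fin: "finite ?G" using tame_F by (auto simp: tame_def)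
          have e: "e \<in> order_boundary (F b)" "e < c"
            using Max_in[OF fin False] by (auto simp: e_def)
          have "{d..c} \<inter> order_boundary (F b) = {}" if "e < d" for d
          proof -
            have "x \<le> e" if "x \<in> order_boundary (F b)" "x < c" for x
              using Max_ge[OF fin, of x] that by (simp add: e_def)
            with that not_bd show ?thesis
              by (fastforce simp: order.order_iff_strict)
          qed
          then have "P (a, b) \<longleftrightarrow> e \<in> right_germ (X (a, b))" if "a \<in> C" for a
            using right_germ_eq[OF tame_X e(2) no_bd] that by (simp add: P_iff)
          moreover obtain i where "nth_least i (order_boundary (F b)) = {e}"
            using nth_least_boundary[OF tame_F e(1)] by blast
          ultimately show ?thesis
            by (intro bexI[of _ "\<lambda>p. \<exists>c. c \<in> nth_least i (order_boundary (F (snd p))) \<and>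
                c \<in> right_germ (X p)"]) (auto simp: \<Psi>_def)
        qed
      qed
    qed
    then obtain \<psi> where "\<psi> \<in> \<Psi>" "{a \<in> C. P (a, b)} = {a \<in> C. \<psi> (a, b)}" by blast
    then show "{a \<in> C. P (a, b)} \<in> (\<Union>\<psi>\<in>\<Psi>. range (\<lambda>b. {a \<in> C. \<psi> (a, b)}))" by blast
  qed
  ultimately show ?case
    by (rule countable_subset[rotated])
qed

section \<open>Countable definable topological spaces\<close>

text \<open>The basic open sets are traces of one definable family on the space.\<close>

theorem definable_topology_second_countable:
  fixes M :: "('f, 'r, 'm::unbounded_dense_linorder) fo_struct"
  assumes omin: "o_minimal M" and T: "definable_topology M T" and count: "countable (topspace T)"
  shows "second_countable T"
proof -
  define A where "A = topspace T"
  obtain n \<phi> k B where A: "definable_set M n A"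
    and \<phi>: "partitioned_form M n k \<phi>" and B: "definable_set M k B"
    and base: "openin T = arbitrary union_of (\<lambda>V. \<exists>b\<in>B. V = fibre M \<phi> A b)"
    using T unfolding definable_topology_def A_def by blast
  obtain \<alpha> m q where \<alpha>: "wf_form M \<alpha>" "A = fibre M \<alpha> {a. length a = n} q"
    using A unfolding definable_set_def partitioned_form_def by blast
  have len_A: "length l = n" if "l \<in> A" for l
    using that by (simp add: \<alpha>(2) fibre_def)
  have len_B: "length l = k" if "l \<in> B" for l
    using B that by (auto simp: definable_set_def fibre_def)

  define PA where "PA a \<longleftrightarrow> map a [0..<n] \<in> A" for a
  have "PA a \<longleftrightarrow> sat M (\<lambda>i. (if i < n then (\<lambda>a. a i) else (\<lambda>_. q ! (i - n))) a) \<alpha>" for a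
  proof -
    have "(\<lambda>i. (map a [0..<n] @ q) ! i) = (\<lambda>i. (if i < n then (\<lambda>a. a i) else (\<lambda>_. q ! (i - n))) a)"
      by (auto simp: nth_append)
    then show ?thesis by (simp add: PA_def \<alpha>(2) fibre_def)
  qed
  then have PA: "definable_over M (coords_of {..<n}) PA"
    unfolding definable_over_def using \<alpha>(1)
    by (intro exI[of _ \<alpha>] exI[of _ "\<lambda>i. if i < n then (\<lambda>a. a i) else (\<lambda>_. q ! (i - n))"])
      (auto simp: coords_of_def coord_terms_def)

  define C where "C = (!) ` A"
  have C: "countable C"
    using count by (simp add: C_def A_def)
  have PA_C: "PA a" if a: "a \<in> C" for a
  proof -
    obtain l where l: "l \<in> A" "a = (!) l" using a unfolding C_def by blast
    have "map a [0..<n] = l" using len_A[OF l(1)] l(2) map_nth by blast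
    then show ?thesis using l(1) by (simp add: PA_def)
  qed
  have C_PA: "\<exists>a'\<in>C. \<forall>i\<in>{..<n}. a i = a' i" if "PA a" for a
    using that by (auto simp: PA_def C_def intro!: bexI[of _ "map a [0..<n]"])

  \<comment> \<open>The variables from \<open>n + k\<close> on are not free in \<open>\<phi>\<close>; they receive a dummy constant.\<close>
  define P where "P p \<longleftrightarrow> sat M (\<lambda>i. (if i < n then (\<lambda>p. fst p i) else
      if i < n + k then (\<lambda>p. snd p (i - n)) else (\<lambda>_. undefined)) p) \<phi>" for p
  have "definable_over M (coords_of {..<n} \<oplus>\<^sub>c coords_of {..<k}) P"
    unfolding definable_over_def
  proof (intro exI conjI allI)
    show "wf_form M \<phi>" using \<phi> by (simp add: partitioned_form_def)
    show "P p \<longleftrightarrow> sat M (\<lambda>i. (if i < n then (\<lambda>p. fst p i) else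
      if i < n + k then (\<lambda>p. snd p (i - n)) else (\<lambda>_. undefined)) p) \<phi>" for p
      by (simp add: P_def)
    show "(if i < n then (\<lambda>p. fst p i) else if i < n + k then (\<lambda>p. snd p (i - n)) else (\<lambda>_. undefined))
        \<in> coord_terms (coords_of {..<n} \<oplus>\<^sub>c coords_of {..<k})" for i
      by (auto simp: coord_terms_def pair_coords_def coords_of_def image_image)
  qed
  from countable_traces[OF omin finite_lessThan finite_lessThan PA C PA_C C_PA this]
  have traces: "countable (range (\<lambda>b. {a \<in> C. P (a, b)}))" .

  have "fibre M \<phi> A b = {l \<in> A. (!) l \<in> {a \<in> C. P (a, (!) b)}}" if "b \<in> B" for b
  proof -
    have "sat M (\<lambda>i. (l @ b) ! i) \<phi> \<longleftrightarrow> P ((!) l, (!) b)" if "l \<in> A" for l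
      unfolding P_def using \<phi> len_A[OF that]
      by (intro sat_cong) (auto simp: partitioned_form_def nth_append)
    then show ?thesis by (auto simp: fibre_def C_def)
  qed
  then have "fibre M \<phi> A ` B \<subseteq> (\<lambda>S. {l \<in> A. (!) l \<in> S}) ` range (\<lambda>b. {a \<in> C. P (a, b)})"
    by blast
  then have "countable (fibre M \<phi> A ` B)"
    using traces by (meson countable_image countable_subset)
  moreover have "(\<lambda>V. \<exists>b\<in>B. V = fibre M \<phi> A b) = (\<lambda>V. V \<in> fibre M \<phi> A ` B)"
    by auto
  ultimately show ?thesis
    unfolding second_countable using base by auto
qed

section \<open>The four spaces are not first countable\<close>

text \<open>Choose \<open>g k\<close> in \<open>W k\<close> and in the \<open>k\<close>-th member of the countable base. For each of the four
  spaces \<open>W k\<close> recedes so fast with \<open>k\<close> that the complement of the range of any such \<open>g\<close> is a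
  neighbourhood of \<open>p\<close>, which contradicts the conclusion.\<close>

lemma first_countable_diagonal:
  assumes "first_countable S" "p \<in> topspace S"
    and meets: "\<And>V k. openin S V \<Longrightarrow> p \<in> V \<Longrightarrow> V \<inter> W k \<noteq> {}"
  shows "\<exists>g :: nat \<Rightarrow> 'a. (\<forall>k. g k \<in> W k) \<and> (\<forall>U. openin S U \<longrightarrow> p \<in> U \<longrightarrow> (\<exists>k. g k \<in> U))"
proof -
  obtain \<B> where \<B>: "countable \<B>" "\<And>V. V \<in> \<B> \<Longrightarrow> openin S V"
      "\<And>U. openin S U \<Longrightarrow> p \<in> U \<Longrightarrow> \<exists>V\<in>\<B>. p \<in> V \<and> V \<subseteq> U"
    using assms(1,2) unfolding first_countable_def by metis
  define \<B>' where "\<B>' = {V \<in> \<B>. p \<in> V}"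
  have "\<B>' \<noteq> {}" "countable \<B>'"
    using \<B>(1) \<B>(3)[OF openin_topspace assms(2)] by (auto simp: \<B>'_def)
  then obtain V :: "nat \<Rightarrow> 'a set" where V: "range V = \<B>'"
    by (metis range_from_nat_into)
  have "\<exists>x. x \<in> V k \<and> x \<in> W k" for k
  proof -
    have "V k \<in> \<B>'" using V by blast
    then show ?thesis using meets[of "V k" k] \<B>(2) by (auto simp: \<B>'_def)
  qed
  then obtain g where g: "\<And>k. g k \<in> V k" "\<And>k. g k \<in> W k"
    by metis
  have "\<exists>k. g k \<in> U" if U: "openin S U" "p \<in> U" for U
  proof -
    obtain B where "B \<in> \<B>'" "B \<subseteq> U" using \<B>(3)[OF U] U(2) by (auto simp: \<B>'_def)
    then show ?thesis using V g(1) by blast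
  qed
  with g(2) show ?thesis by blast
qed

text \<open>With \<open>g k\<close> in a column of index at least \<open>k\<close>, every column meets the range of \<open>g\<close> in a
  finite set, so the complement of that range is open.\<close>

lemma not_first_countable_arens: "\<not> first_countable arens_space"
proof
  assume fc: "first_countable arens_space"
  have p: "ArensInf \<in> topspace arens_space"
    by (simp add: topspace_arens_space)
  have meets: "V \<inter> {ArensDbl n m | n m. n \<ge> k} \<noteq> {}" if "openin arens_space V" "ArensInf \<in> V" for V k
  proof -
    have "\<forall>\<^sub>F n in sequentially. ArensSeq n \<in> V"
      using that by (simp add: openin_arens_space cofinite_eq_sequentially)
    then obtain N where "\<And>n. n \<ge> N \<Longrightarrow> ArensSeq n \<in> V"
      unfolding eventually_sequentially by blast
    then obtain n where n: "ArensSeq n \<in> V" "n \<ge> k"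
      by (meson max.cobounded1 max.cobounded2)
    then have "\<forall>\<^sub>F m in sequentially. ArensDbl n m \<in> V"
      using that by (simp add: openin_arens_space cofinite_eq_sequentially)
    then obtain m where "ArensDbl n m \<in> V"
      unfolding eventually_sequentially by blast
    then show ?thesis using n by blast
  qed
  obtain g where g: "\<And>k. g k \<in> {ArensDbl n m | n m. n \<ge> k}"
      and hit: "\<And>U. openin arens_space U \<Longrightarrow> ArensInf \<in> U \<Longrightarrow> \<exists>k. g k \<in> U"
    using first_countable_diagonal[where W = "\<lambda>k. {ArensDbl n m | n m. n \<ge> k}", OF fc p meets] by blast
  have dbl: "\<exists>n m. p = ArensDbl n m" if "p \<in> range g" for p
    using g that by blast
  have "openin arens_space (- range g)"
    unfolding openin_arens_space
  proof (intro conjI impI allI)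
    from dbl have "ArensSeq n \<notin> range g" for n by blast
    then show "\<forall>\<^sub>F n in cofinite. ArensSeq n \<in> - range g" by simp
    fix n
    have "{m. ArensDbl n m \<in> range g} \<subseteq> (\<lambda>k. THE m. g k = ArensDbl n m) ` {..n}"
    proof
      fix m assume "m \<in> {m. ArensDbl n m \<in> range g}"
      then obtain k where k: "g k = ArensDbl n m" by auto
      then have "k \<le> n" using g[of k] by auto
      with k show "m \<in> (\<lambda>k. THE m. g k = ArensDbl n m) ` {..n}"
        by (intro image_eqI[of _ _ k]) auto
    qed
    then have "finite {m. ArensDbl n m \<in> range g}"
      by (rule finite_subset) simp
    then show "\<forall>\<^sub>F m in cofinite. ArensDbl n m \<in> - range g"
      by (simp add: eventually_cofinite)
  qed
  moreover have "ArensInf \<in> - range g" using dbl by blast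
  ultimately show False using hit by blast
qed

text \<open>The same diagonal sequence works at the point \<open>MCX\<close>, with rows in place of columns.\<close>

lemma not_first_countable_max_compact: "\<not> first_countable max_compact_space"
proof
  assume fc: "first_countable max_compact_space"
  have p: "MCX \<in> topspace max_compact_space"
    by (simp add: topspace_max_compact_space mc_set_def)
  have meets: "V \<inter> {MCPair i j | i j. 0 < i \<and> 0 < j \<and> k \<le> j} \<noteq> {}"
    if V: "openin max_compact_space V" "MCX \<in> V" for V k
  proof -
    obtain U where U: "U \<in> mc_base" "MCX \<in> U" "U \<subseteq> V"
      using V unfolding openin_max_compact_space union_of_def by blast
    then obtain P where P: "U = mc_set - ({MCY} \<union> P)" "\<forall>j>0. finite (P \<inter> mc_row j)"
      by (auto simp: mc_base_def mc_grid_def)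
    define j where "j = Suc k"
    have "mc_row j = (\<lambda>i. MCPair i j) ` {0<..}"
      by (auto simp: mc_row_def)
    moreover have "inj_on (\<lambda>i. MCPair i j) {0<..}"
      by (simp add: inj_on_def)
    ultimately have "infinite (mc_row j)"
      using infinite_Ioi[of "0::nat"] by (simp add: finite_image_iff)
    moreover have "finite (P \<inter> mc_row j)" using P(2) by (simp add: j_def)
    ultimately have "\<not> mc_row j \<subseteq> P" by (metis inf.absorb2)
    then obtain i where "0 < i" "MCPair i j \<notin> P" by (auto simp: mc_row_def)
    then have "MCPair i j \<in> U" by (auto simp: P(1) mc_set_def mc_grid_def j_def)
    then show ?thesis using \<open>0 < i\<close> U(3) by (auto simp: j_def)
  qed
  obtain g where g: "\<And>k. g k \<in> {MCPair i j | i j. 0 < i \<and> 0 < j \<and> k \<le> j}"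
      and hit: "\<And>U. openin max_compact_space U \<Longrightarrow> MCX \<in> U \<Longrightarrow> \<exists>k. g k \<in> U"
    using first_countable_diagonal[where W = "\<lambda>k. {MCPair i j | i j. 0 < i \<and> 0 < j \<and> k \<le> j}", OF fc p meets] by blast
  have "finite (range g \<inter> mc_row j)" for j
  proof (rule finite_subset)
    show "range g \<inter> mc_row j \<subseteq> g ` {..j}"
    proof
      fix x assume "x \<in> range g \<inter> mc_row j"
      then obtain k where "x = g k" "g k \<in> mc_row j" by auto
      with g[of k] show "x \<in> g ` {..j}" by (auto simp: mc_row_def)
    qed
  qed simp
  moreover have grid: "range g \<subseteq> mc_grid"
    using g by (fastforce simp: mc_grid_def)
  ultimately have "mc_set - ({MCY} \<union> range g) \<in> mc_base"
    unfolding mc_base_def by blast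
  then have "openin max_compact_space (mc_set - ({MCY} \<union> range g))"
    unfolding openin_max_compact_space arbitrary_def by (simp add: union_of_inc)
  moreover have "MCX \<in> mc_set - ({MCY} \<union> range g)"
    using grid by (auto simp: mc_set_def mc_grid_def)
  ultimately show False using hit by blast
qed

text \<open>Neighbourhoods of infinity have compact complement in the rationals, and compact sets of
  rationals have empty interior. So there are points outside any one of them arbitrarily near \<open>0\<close>.
  Yet a sequence of rationals that tends to \<open>0\<close>, together with its limit, is compact.\<close>

lemma not_first_countable_rat_compactification: "\<not> first_countable rat_compactification"
proof
  assume fc: "first_countable rat_compactification"
  define W where "W k = Some ` {q \<in> \<rat>. 0 < q \<and> q < 1 / real (Suc k)}" for k
  have p: "None \<in> topspace rat_compactification"
    by (simp add: rat_compactification_def)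
  have meets: "V \<inter> W k \<noteq> {}" if V: "openin rat_compactification V" "None \<in> V" for V k
  proof
    assume "V \<inter> W k = {}"
    obtain K where K: "K \<subseteq> \<rat>" "compact K" "V = insert None (Some ` (\<rat> - K))"
      using V unfolding openin_rat_compactification by blast
    let ?I = "{0<..<1 / real (Suc k)}"
    have "\<rat> \<inter> ?I \<subseteq> K"
      using \<open>V \<inter> W k = {}\<close> by (auto simp: K(3) W_def)
    moreover have "?I \<subseteq> closure (\<rat> \<inter> ?I)"
      using open_Int_closure_subset[of ?I "\<rat> :: real set"] Rats_closure_real
      by (simp add: Int_commute)
    ultimately have "?I \<subseteq> K"
      using closure_minimal[OF _ compact_imp_closed[OF K(2)]] by (meson subset_trans)
    then have "?I \<subseteq> \<rat>" using K(1) by (rule subset_trans)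
    then have "countable ?I" by (rule countable_subset[OF _ countable_rat])
    then show False using uncountable_open_interval[of 0 "1 / real (Suc k)"] by simp
  qed
  obtain g where g: "\<And>k. g k \<in> W k"
      and hit: "\<And>U. openin rat_compactification U \<Longrightarrow> None \<in> U \<Longrightarrow> \<exists>k. g k \<in> U"
    using first_countable_diagonal[where W = W, OF fc p meets] by metis
  define f where "f = the \<circ> g"
  have f: "g k = Some (f k)" "f k \<in> \<rat>" "0 < f k" "f k < 1 / real (Suc k)" for k
    using g[of k] by (auto simp: f_def W_def)
  have "f \<longlonglongrightarrow> 0"
  proof (rule tendsto_sandwich[of "\<lambda>_. 0" f sequentially "\<lambda>k. 1 / real (Suc k)"])
    show "(\<lambda>k. 1 / real (Suc k)) \<longlonglongrightarrow> 0"
      using LIMSEQ_inverse_real_of_nat by (simp add: inverse_eq_divide)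
  qed (use f in \<open>auto simp: less_imp_le\<close>)
  then have "compact (insert 0 (range f))"
    by (rule compact_sequence_with_limit)
  moreover have "insert 0 (range f) \<subseteq> \<rat>"
    using f by auto
  ultimately have "openin rat_compactification (insert None (Some ` (\<rat> - insert 0 (range f))))"
    unfolding openin_rat_compactification by blast
  then obtain k where "g k \<in> insert None (Some ` (\<rat> - insert 0 (range f)))"
    using hit by blast
  then show False by (auto simp: f(1))
qed

text \<open>Since \<open>g k\<close> exceeds \<open>k\<^sup>2\<close>, at most \<open>sqrt n + 1\<close> values of \<open>g\<close> are at most \<open>n\<close>: the range
  of \<open>g\<close> has density zero, and its complement is a neighbourhood of \<open>1\<close>.\<close>

lemma not_first_countable_appert: "\<not> first_countable appert_space"
proof
  assume fc: "first_countable appert_space"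
  have p: "1 \<in> topspace appert_space"
    by (simp add: topspace_appert_space)
  have meets: "V \<inter> {m. 1 < m \<and> k\<^sup>2 < m} \<noteq> {}" if V: "openin appert_space V" "1 \<in> V" for V k
  proof
    assume *: "V \<inter> {m. 1 < m \<and> k\<^sup>2 < m} = {}"
    have lim: "(\<lambda>n. real (appert_count n V) / real n) \<longlonglongrightarrow> 1"
      using V by (simp add: openin_appert_space appert_open_def)
    have "V \<subseteq> {..1 + k\<^sup>2}" using * by fastforce
    then have "appert_count n V \<le> card {..1 + k\<^sup>2}" for n
      unfolding appert_count_def by (intro card_mono) auto
    then have le: "appert_count n V \<le> 2 + k\<^sup>2" for n by simp
    have "(\<lambda>n. real (appert_count n V) / real n) \<longlonglongrightarrow> 0"
    proof (rule tendsto_sandwich[of "\<lambda>_. 0" _ sequentially "\<lambda>n. real (2 + k\<^sup>2) / real n"])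
      show "(\<lambda>n. real (2 + k\<^sup>2) / real n) \<longlonglongrightarrow> 0"
        by (rule lim_const_over_n)
      show "\<forall>\<^sub>F n in sequentially. real (appert_count n V) / real n \<le> real (2 + k\<^sup>2) / real n"
        using le by (intro always_eventually allI divide_right_mono) (simp_all only: of_nat_le_iff of_nat_0_le_iff)
    qed auto
    with lim show False using LIMSEQ_unique by fastforce
  qed
  obtain g where g: "\<And>k. g k \<in> {m. 1 < m \<and> k\<^sup>2 < m}"
      and hit: "\<And>U. openin appert_space U \<Longrightarrow> 1 \<in> U \<Longrightarrow> \<exists>k. g k \<in> U"
    using first_countable_diagonal[where W = "\<lambda>k. {m. 1 < m \<and> k\<^sup>2 < m}", OF fc p meets] by blast
  define E where "E = {0<..} - range g"
  have "real n - sqrt (real n) - 1 \<le> real (appert_count n E)" for n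
  proof -
    define s where "s = nat \<lfloor>sqrt (real n)\<rfloor>"
    have sub: "{0<..n} \<subseteq> {m \<in> E. m \<le> n} \<union> g ` {k. k\<^sup>2 \<le> n}"
    proof
      fix m assume m: "m \<in> {0<..n}"
      show "m \<in> {m \<in> E. m \<le> n} \<union> g ` {k. k\<^sup>2 \<le> n}"
      proof (cases "m \<in> range g")
        case True
        then obtain k where "m = g k" by blast
        moreover from this have "k\<^sup>2 \<le> n" using g[of k] m by auto
        ultimately show ?thesis by blast
      qed (use m in \<open>auto simp: E_def\<close>)
    qed
    have k: "{k. k\<^sup>2 \<le> n} \<subseteq> {..s}"
    proof
      fix k assume "k \<in> {k. k\<^sup>2 \<le> n}"
      then have "real k \<le> sqrt (real n)"
        by (intro real_le_rsqrt) (simp flip: of_nat_power)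
      then show "k \<in> {..s}" by (simp add: s_def le_nat_floor)
    qed
    then have fin: "finite {k. k\<^sup>2 \<le> n}" by (rule finite_subset) simp
    have "n = card {0<..n}" by simp
    also have "\<dots> \<le> card ({m \<in> E. m \<le> n} \<union> g ` {k. k\<^sup>2 \<le> n})"
      using fin sub by (intro card_mono) auto
    also have "\<dots> \<le> appert_count n E + card (g ` {k. k\<^sup>2 \<le> n})"
      unfolding appert_count_def by (rule card_Un_le)
    also have "card (g ` {k. k\<^sup>2 \<le> n}) \<le> card {..s}"
      by (rule order_trans[OF card_image_le[OF fin] card_mono[OF finite_atMost k]])
    finally have "n \<le> appert_count n E + s + 1" by simp
    then have "real n \<le> real (appert_count n E) + real s + 1" by linarith
    moreover have "real s \<le> sqrt (real n)" by (simp add: s_def)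
    ultimately show ?thesis by linarith
  qed
  moreover have "appert_count n E \<le> n" for n
  proof -
    have "card {m \<in> E. m \<le> n} \<le> card {0<..n}"
      by (intro card_mono) (auto simp: E_def)
    then show ?thesis by (simp add: appert_count_def)
  qed
  ultimately have bounds: "(real n - sqrt (real n) - 1) / real n \<le> real (appert_count n E) / real n"
    "real (appert_count n E) / real n \<le> 1" for n
    by (auto intro!: divide_right_mono simp: divide_le_eq)
  have "(\<lambda>n. real (appert_count n E) / real n) \<longlonglongrightarrow> 1"
  proof (rule tendsto_sandwich)
    show "\<forall>\<^sub>F n in sequentially.
        (real n - sqrt (real n) - 1) / real n \<le> real (appert_count n E) / real n"
      using bounds(1) by (intro always_eventually allI)
    show "\<forall>\<^sub>F n in sequentially. real (appert_count n E) / real n \<le> 1"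
      using bounds(2) by (intro always_eventually allI)
    show "(\<lambda>n. (real n - sqrt (real n) - 1) / real n) \<longlonglongrightarrow> 1"
      by real_asymp
  qed simp
  moreover have "1 \<notin> range g"
    using g by force
  ultimately have "openin appert_space E" "1 \<in> E"
    by (auto simp: openin_appert_space appert_open_def E_def)
  then show False using hit by (auto simp: E_def)
qed

theorem corollary3:
  fixes M :: "('f, 'r, 'm::unbounded_dense_linorder) fo_struct"
  assumes "o_minimal M"
  shows "\<not> (\<exists>T. definable_topology M T \<and> T homeomorphic_space arens_space) \<and>
         \<not> (\<exists>T. definable_topology M T \<and> T homeomorphic_space max_compact_space) \<and>
         \<not> (\<exists>T. definable_topology M T \<and> T homeomorphic_space rat_compactification) \<and>
         \<not> (\<exists>T. definable_topology M T \<and> T homeomorphic_space appert_space)"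
proof -
  have not_definable: "\<not> (\<exists>T. definable_topology M T \<and> T homeomorphic_space S)"
    if "countable (topspace S)" "\<not> first_countable S" for S :: "'b topology"
  proof
    assume "\<exists>T. definable_topology M T \<and> T homeomorphic_space S"
    then obtain T where T: "definable_topology M T" "T homeomorphic_space S" by blast
    then obtain f g where fg: "continuous_map T S f" "\<forall>x\<in>topspace T. g (f x) = x"
      unfolding homeomorphic_space_def homeomorphic_maps_def by blast
    have "topspace T \<subseteq> g ` topspace S"
    proof
      fix x assume "x \<in> topspace T"
      then have "f x \<in> topspace S" "x = g (f x)"
        using fg continuous_map_image_subset_topspace[OF fg(1)] by auto
      then show "x \<in> g ` topspace S" by (rule rev_image_eqI)
    qed
    then have "countable (topspace T)"
      using that(1) by (meson countable_image countable_subset)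
    then have "second_countable T"
      by (rule definable_topology_second_countable[OF assms T(1)])
    then have "first_countable S"
      using T(2) homeomorphic_space_first_countability second_countable_imp_first_countable by blast
    with that(2) show False ..
  qed
  have "topspace arens_space \<subseteq> {ArensInf} \<union> range ArensSeq \<union> range (\<lambda>(n, m). ArensDbl n m)"
  proof
    fix p
    show "p \<in> {ArensInf} \<union> range ArensSeq \<union> range (\<lambda>(n, m). ArensDbl n m)"
      by (cases p) auto
  qed
  then have "countable (topspace arens_space)"
    by (rule countable_subset) simp
  moreover have "mc_set \<subseteq> {MCX, MCY} \<union> range (\<lambda>(i, j). MCPair i j)"
    by (auto simp: mc_set_def mc_grid_def)
  then have "countable (topspace max_compact_space)"
    unfolding topspace_max_compact_space
    by (rule countable_subset) simp
  moreover have "countable (topspace rat_compactification)"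
    by (simp add: rat_compactification_def countable_rat)
  moreover have "countable (topspace appert_space)"
    by simp
  ultimately show ?thesis
    by (intro conjI not_definable not_first_countable_arens not_first_countable_max_compact
        not_first_countable_rat_compactification not_first_countable_appert)
qed

end
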